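(* Let $(P_n)_{n\ge1}$ be a sequence of convex polyhedra in $\mathbb{R}^3$ such that: (i) $m(P_n)\to\inf\{m(P):P\text{ a convex polyhedron}\}$; (ii) for every $n$, if $P_n\ne P_{n+1}$ (up to scaling), then $P_n$ has fewer faces than $P_{n+1}$; (iii) for every $n$, $P_n$ minimizes $m$ among all convex polyhedra with the same number of faces as $P_n$. Then for every $n$, every vertex of $P_n$ has degree $3$.
   Context: A convex polyhedron is a compact convex polyhedron in $\mathbb{R}^3$ with nonempty interior. For a polyhedron $P$, $e(P)$ is its total edge length, $v(P)$ its volume, and the Melzak ratio is $m(P)=e(P)^3/v(P)$. The degree of a vertex is the number of edges meeting at it. *)

theory Defs
  imports "HOL-Analysis.Analysis"
begin

definition convex_polyhedron :: "(real^3) set \<Rightarrow> bool" where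
  "convex_polyhedron P \<longleftrightarrow> polyhedron P \<and> compact P \<and> interior P \<noteq> {}"

(* An edge is a line segment, so its length is its diameter. *)
definition total_edge_length :: "(real^3) set \<Rightarrow> real" where
  "total_edge_length P = (\<Sum>E | E edge_of P. diameter E)"

definition volume :: "(real^3) set \<Rightarrow> real" where
  "volume P = measure lebesgue P"

definition melzak_ratio :: "(real^3) set \<Rightarrow> real" where
  "melzak_ratio P = (total_edge_length P) ^ 3 / volume P"

(* The faces of a polyhedron in the classical sense are the two-dimensional ones,
   i.e. the facets; the library's face_of relation admits faces of every dimension. *)
definition num_faces :: "(real^3) set \<Rightarrow> nat" where
  "num_faces P = card {F. F facet_of P}"

definition vertex_degree :: "(real^3) set \<Rightarrow> real^3 \<Rightarrow> nat" where
  "vertex_degree P v = card {E. E edge_of P \<and> v \<in> E}"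

definition equal_up_to_scaling :: "(real^3) set \<Rightarrow> (real^3) set \<Rightarrow> bool" where
  "equal_up_to_scaling P Q \<longleftrightarrow> (\<exists>c>0. Q = (\<lambda>x. c *\<^sub>R x) ` P)"

end

theory Submission
  imports Defs
begin

text \<open>
Let \<open>v\<close> be a vertex of a polyhedron \<open>P\<close> that lies on at least four facets. Move the plane of one of these facets
parallel to itself, a little outwards or inwards by an amount \<open>s\<close>. The number of facets does not change. The
volume is differentiable in this motion, whereas the total edge length \<open>e\<close> has a concave kink:
\<open>e(s) + e(-s) \<le> 2 e(0) - \<kappa> s\<close> with \<open>\<kappa> > 0\<close>. The quotient \<open>e\<^sup>3 / vol\<close> cannot have a minimum
at such a kink (\<open>concave_kink_not_minimal\<close>). So every vertex of a polyhedron that is minimal for its number of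
facets lies on exactly three facets (\<open>minimizer_vertex_simple\<close>), and then exactly three edges meet in it, one for
each pair of these facets (\<open>degree_of_simple_vertex\<close>).

The kink is the heart of the matter (\<open>edge_length_concave_kink\<close>). The way in which a vertex of high degree splits
into several vertices depends on the direction of the motion, and following the edges individually would require a
description of the new combinatorial structure. Crofton's formula avoids this. In a direction \<open>u\<close>, the sides of
a polygon have twice the width of the polygon in total (\<open>polygon_side_widths\<close>), and each edge of \<open>P\<close> is a side
of two facets; so the widths of the edges and the widths of the facets have the same sum. On averaging over
\<open>u\<close>, the widths of the edges turn into their lengths, and the total edge length becomes a multiple of the mean
of the sum of the facet widths (\<open>crofton_facets\<close>).

The facets are easy to follow. The midpoint of a point on a facet of the polyhedron moved outwards and a point on the
corresponding facet of the polyhedron moved inwards lies on the corresponding facet of \<open>P\<close>, so all widths are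
midpoint concave. The concavity is strict at order \<open>s\<close> for an open set of directions: any three facets
through \<open>v\<close> have independent normals (\<open>three_normals_independent\<close>), so \<open>v\<close> remains a vertex when the moved
facet is omitted. For \<open>u\<close> inside the normal cone of this vertex, the maximum of \<open>u\<close> on the moved facet
cannot exceed \<open>u \<bullet> v\<close>, and it drops linearly when the facet moves inwards.

The derivative of the volume is not computed. It is enough that the slab gained in the outward motion has, to
first order, at least the volume of the slab lost in the inward motion (\<open>volume_outward_shift\<close>), and this is seen
by mapping the second slab into the first.
\<close>

section \<open>Widths of polygons\<close>

text \<open>The factor \<open>norm u\<close> contained in this quantity is deliberate: it makes the width of a segment
from \<open>p\<close> to \<open>q\<close> equal to \<open>\<bar>u \<bullet> (p - q)\<bar>\<close> for every \<open>u\<close>, which can be averaged over a ball.\<close>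

definition width :: "'a::euclidean_space \<Rightarrow> 'a set \<Rightarrow> real" where
  "width u K = Sup ((\<bullet>) u ` K) - Inf ((\<bullet>) u ` K)"

lemma inner_image_compact_convex:
  fixes K :: "'a::euclidean_space set"
  assumes "compact K" "convex K" "K \<noteq> {}"
  shows "(\<bullet>) u ` K = {Inf ((\<bullet>) u ` K) .. Sup ((\<bullet>) u ` K)}"
    and "Inf ((\<bullet>) u ` K) \<le> Sup ((\<bullet>) u ` K)"
proof -
  have c: "compact ((\<bullet>) u ` K)"
    by (intro compact_continuous_image continuous_intros assms)
  moreover have "convex ((\<bullet>) u ` K)"
    by (intro convex_linear_image assms bounded_linear.linear bounded_linear_inner_right)
  ultimately obtain a b where ab: "(\<bullet>) u ` K = {a..b}"
    by (metis connected_compact_interval_1 box_real(2) convex_connected)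
  then have "a \<le> b" using assms(3) by force
  with ab show "(\<bullet>) u ` K = {Inf ((\<bullet>) u ` K) .. Sup ((\<bullet>) u ` K)}"
    and "Inf ((\<bullet>) u ` K) \<le> Sup ((\<bullet>) u ` K)" by auto
qed

lemma width_eq_measure:
  fixes K :: "'a::euclidean_space set"
  assumes "compact K" "convex K" "K \<noteq> {}"
  shows "width u K = measure lborel ((\<bullet>) u ` K)"
  using inner_image_compact_convex[OF assms, of u] unfolding width_def
  by (metis measure_lborel_Icc)

text \<open>The line \<open>u \<bullet> x = c\<close> runs through the relative interior of the polygon, so it cuts out a
nondegenerate segment whose endpoints are on the boundary. An endpoint lies on one side only, because a
common point of two sides is a vertex, and \<open>c\<close> avoids the heights of the vertices. The two endpoints are on
different sides, since a side through both would contain the segment and meet the relative interior.\<close>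

lemma polygon_generic_section:
  fixes F :: "'a::euclidean_space set"
  assumes F: "polytope F" "aff_dim F = 2"
    and c: "Inf ((\<bullet>) u ` F) < c" "c < Sup ((\<bullet>) u ` F)"
    and gen: "\<And>p. p extreme_point_of F \<Longrightarrow> u \<bullet> p \<noteq> c"
  shows "card {E. E facet_of F \<and> c \<in> (\<bullet>) u ` E} = 2"
proof -
  define L where "L = {x. u \<bullet> x = c}"
  have cF: "convex F" "compact F" "F \<noteq> {}" and poly: "polyhedron F"
    using F polytope_imp_convex polytope_imp_compact polytope_imp_polyhedron by auto
  have L: "affine L" "convex L" "closed L"
    by (auto simp: L_def affine_hyperplane convex_hyperplane closed_hyperplane)
  have "rel_interior ((\<bullet>) u ` F) = (\<bullet>) u ` rel_interior F"
    using rel_interior_convex_linear_image[of "(\<bullet>) u" F] cF(1) bounded_linear.linear[OF bounded_linear_inner_right]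
    by blast
  moreover have "rel_interior ((\<bullet>) u ` F) = {Inf ((\<bullet>) u ` F) <..< Sup ((\<bullet>) u ` F)}"
    using rel_interior_real_box[of "Inf ((\<bullet>) u ` F)" "Sup ((\<bullet>) u ` F)"] c
    by (subst inner_image_compact_convex(1)[OF cF(2,1,3), of u]) simp
  ultimately have "c \<in> (\<bullet>) u ` rel_interior F" using c by auto
  then obtain x where x: "x \<in> rel_interior F" "x \<in> L" by (auto simp: L_def)
  have riL: "rel_interior L = L" using L(1) by (simp add: affine_imp_convex rel_interior_affine)
  have ri: "rel_interior (F \<inter> L) = rel_interior F \<inter> L"
    using convex_rel_interior_inter_two[OF cF(1) L(2)] x riL by auto
  define S where "S = affine hull F \<inter> L"
  have affS: "affine S" unfolding S_def using L by (simp add: affine_Int)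
  have notsub: "\<not> affine hull F \<subseteq> L"
  proof
    assume "affine hull F \<subseteq> L"
    then have "F \<subseteq> L" using hull_subset[of F affine] by (rule order_trans[rotated])
    then have "(\<bullet>) u ` F \<subseteq> {c}" unfolding L_def by blast
    then have "(\<bullet>) u ` F = {c}" using cF(3) by (simp add: subset_singleton_iff)
    then have "Sup ((\<bullet>) u ` F) = c" by simp
    then show False using c(2) by simp
  qed
  have "x \<in> S" using x rel_interior_subset[of F] hull_subset[of F affine] unfolding S_def by blast
  then have dimS: "aff_dim S = 1"
    using aff_dim_affine_Int_hyperplane[of "affine hull F" u c] notsub F(2)
    unfolding S_def L_def by auto
  have "openin (top_of_set S) (rel_interior F \<inter> L)"
  proof -
    have "openin (top_of_set (affine hull F)) (rel_interior F)" by (rule openin_rel_interior)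
    then obtain T where "open T" "rel_interior F = affine hull F \<inter> T" by (auto simp: openin_open)
    then show ?thesis unfolding S_def openin_open by blast
  qed
  then have "aff_dim (rel_interior F \<inter> L) = 1"
    using aff_dim_openin[OF _ affS] x dimS by auto
  moreover have "rel_interior F \<inter> L \<subseteq> F \<inter> L" using rel_interior_subset by blast
  moreover have "F \<inter> L \<subseteq> S" unfolding S_def using hull_subset[of F affine] by blast
  ultimately have dimK: "aff_dim (F \<inter> L) = 1"
    by (metis aff_dim_subset dimS order_antisym)
  then have "collinear (F \<inter> L)" by (simp add: collinear_aff_dim)
  moreover have "compact (F \<inter> L)" "convex (F \<inter> L)" "F \<inter> L \<noteq> {}"
    using cF L x rel_interior_subset by (auto simp: compact_Int_closed convex_Int)
  ultimately obtain p q where pq: "F \<inter> L = closed_segment p q"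
    by (meson compact_convex_collinear_segment)
  have "p \<noteq> q" using dimK pq by auto
  then have riK: "open_segment p q = rel_interior F \<inter> L"
    using ri pq by (metis rel_interior_closed_segment)
  have pqF: "p \<in> F" "q \<in> F" "p \<in> L" "q \<in> L" using pq ends_in_segment by blast+
  have bd: "F - rel_interior F = \<Union> {E. E facet_of F}"
    using rel_boundary_of_polyhedron[OF poly] .
  have "p \<notin> rel_interior F" "q \<notin> rel_interior F"
    using riK pqF by (auto simp: set_eq_iff open_segment_def)
  then have "p \<in> \<Union> {E. E facet_of F}" "q \<in> \<Union> {E. E facet_of F}"
    using bd pqF by blast+
  then obtain Ep Eq where E: "Ep facet_of F" "p \<in> Ep" "Eq facet_of F" "q \<in> Eq"
    by blast
  have uniq: "E = E'" if "E facet_of F" "E' facet_of F" "y \<in> E" "y \<in> E'" "y \<in> L" for E E' y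
  proof (rule ccontr)
    assume "E \<noteq> E'"
    have f: "E face_of F" "E' face_of F" "aff_dim E = 1" "aff_dim E' = 1"
      using that F(2) by (auto simp: facet_of_def)
    have EI: "E \<inter> E' face_of F" using face_of_Int f by blast
    have "E \<inter> E' \<noteq> E"
    proof
      assume "E \<inter> E' = E"
      then have "E face_of E'" using f face_of_face by blast
      then show False using face_of_aff_dim_lt[of E' E] f \<open>E \<noteq> E'\<close> face_of_imp_convex by force
    qed
    moreover have "E \<inter> E' face_of E" using EI f face_of_face by blast
    ultimately have "aff_dim (E \<inter> E') < 1"
      using face_of_aff_dim_lt[of E "E \<inter> E'"] f face_of_imp_convex by force
    moreover have "aff_dim (E \<inter> E') \<ge> 0" using that by (metis IntI aff_dim_negative_iff empty_iff linorder_not_le)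
    ultimately have "aff_dim (E \<inter> E') = 0" by simp
    then have "E \<inter> E' = {y}" using that by (metis IntI aff_dim_eq_0 singletonD)
    then have "y extreme_point_of F" using EI by (simp add: face_of_singleton)
    then show False using gen that(5) by (auto simp: L_def)
  qed
  have "Ep \<noteq> Eq"
  proof
    assume eq: "Ep = Eq"
    have "convex Ep" using E(1) by (meson face_of_imp_convex facet_of_def)
    then have "open_segment p q \<subseteq> Ep" using E eq
      by (meson closed_segment_subset segment_open_subset_closed subset_trans)
    then have "x \<in> Ep" using riK x by blast
    then show False using x(1) bd E(1) by blast
  qed
  have "{E. E facet_of F \<and> c \<in> (\<bullet>) u ` E} = {Ep, Eq}"
  proof (intro equalityI subsetI)
    fix E assume "E \<in> {E. E facet_of F \<and> c \<in> (\<bullet>) u ` E}"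
    then obtain y where y: "E facet_of F" "y \<in> E" "y \<in> L" by (auto simp: L_def)
    then have "y \<in> closed_segment p q" using facet_of_imp_subset pq by blast
    moreover have "y \<notin> open_segment p q" using y bd riK by blast
    ultimately have "y = p \<or> y = q" by (auto simp: open_segment_def)
    then show "E \<in> {Ep, Eq}" using uniq y E pqF by blast
  next
    fix E assume "E \<in> {Ep, Eq}"
    moreover have "c = u \<bullet> p" "c = u \<bullet> q" using pqF by (auto simp: L_def)
    ultimately show "E \<in> {E. E facet_of F \<and> c \<in> (\<bullet>) u ` E}" using E by blast
  qed
  with \<open>Ep \<noteq> Eq\<close> show ?thesis by simp
qed

text \<open>Integrating the previous count over all levels \<open>c\<close> gives the claim: the levels met by a set form an
interval whose length is its width, and only finitely many levels are exceptional.\<close>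

lemma polygon_side_widths:
  fixes F :: "'a::euclidean_space set"
  assumes F: "polytope F" "aff_dim F = 2"
  shows "(\<Sum>E | E facet_of F. width u E) = 2 * width u F"
proof -
  let ?u = "\<lambda>K. (\<bullet>) u ` K"
  have cF: "convex F" "compact F" "F \<noteq> {}" and poly: "polyhedron F"
    using F polytope_imp_convex polytope_imp_compact polytope_imp_polyhedron by auto
  have fin: "finite {E. E facet_of F}" using F finite_polytope_facets by blast
  have cE: "compact E" "convex E" "E \<noteq> {}" "E \<subseteq> F" if "E facet_of F" for E
    using that cF face_of_imp_compact face_of_imp_convex facet_of_imp_subset unfolding facet_of_def by blast+
  have int: "integrable lborel (indicator (?u K) :: real \<Rightarrow> real)" if "compact K" "convex K" "K \<noteq> {}" for K
  proof -
    have "compact (?u K)" by (intro compact_continuous_image continuous_intros that)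
    then show ?thesis
      by (metis borel_compact emeasure_compact_finite integrable_real_indicator sets_lborel)
  qed
  have m: "(LINT c|lborel. indicator (?u K) c) = width u K" if "compact K" "convex K" "K \<noteq> {}" for K
    using width_eq_measure[OF that, of u] by simp
  \<comment> \<open>the exceptional levels: heights of vertices, and the two ends of the range\<close>
  define Z where "Z = ((\<bullet>) u ` {p. p extreme_point_of F}) \<union> {Inf (?u F), Sup (?u F)}"
  have "finite Z" unfolding Z_def using finite_polyhedron_extreme_points[OF poly] by auto
  then have "Z \<in> null_sets lborel" by (simp add: finite_imp_null_set_lborel)
  then have "AE c in lborel. c \<notin> Z" by (rule AE_not_in)
  moreover have pt: "(\<Sum>E | E facet_of F. indicator (?u E) c) = (2 * indicator (?u F) c :: real)" if "c \<notin> Z" for c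
  proof (cases "Inf (?u F) < c \<and> c < Sup (?u F)")
    case True
    have "(\<Sum>E | E facet_of F. indicator (?u E) c) = real (card {E. E facet_of F \<and> c \<in> ?u E})"
      using fin by (simp add: indicator_def sum.If_cases Int_def conj_commute)
    also have "\<dots> = 2"
      using polygon_generic_section[OF F, of u c] True that by (force simp: Z_def)
    moreover have "c \<in> ?u F"
      using True by (subst inner_image_compact_convex(1)[OF cF(2,1,3), of u]) simp
    ultimately show ?thesis by simp
  next
    case False
    then have "c \<notin> ?u F"
      using that by (subst inner_image_compact_convex(1)[OF cF(2,1,3), of u]) (auto simp: Z_def)
    then have z: "indicator (?u E) c = (0::real)" if "E facet_of F" for E
      using cE(4)[OF that] by (auto simp: indicator_def)
    show ?thesis using \<open>c \<notin> ?u F\<close> z by simp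
  qed
  ultimately have "AE c in lborel. (\<Sum>E | E facet_of F. indicator (?u E) c) = (2 * indicator (?u F) c :: real)"
    by (auto elim: eventually_mono)
  then have "(LINT c|lborel. (\<Sum>E | E facet_of F. indicator (?u E) c)) = (LINT c|lborel. (2 * indicator (?u F) c :: real))"
    using int cF cE by (intro integral_cong_AE borel_measurable_sum) (auto intro!: borel_measurable_integrable)
  moreover have "(LINT c|lborel. (\<Sum>E | E facet_of F. indicator (?u E) c)) = (\<Sum>E | E facet_of F. width u E)"
    using int m cE by (subst Bochner_Integration.integral_sum) auto
  ultimately show ?thesis using m[OF cF(2,1,3)] by simp
qed

section \<open>Irredundant systems of linear inequalities\<close>

definition hpoly :: "'i set \<Rightarrow> ('i \<Rightarrow> 'a::euclidean_space) \<Rightarrow> ('i \<Rightarrow> real) \<Rightarrow> 'a set" where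
  "hpoly I a b = {x. \<forall>i\<in>I. a i \<bullet> x \<le> b i}"

definition hface :: "'i set \<Rightarrow> ('i \<Rightarrow> 'a::euclidean_space) \<Rightarrow> ('i \<Rightarrow> real) \<Rightarrow> 'i \<Rightarrow> 'a set" where
  "hface I a b i = {x \<in> hpoly I a b. a i \<bullet> x = b i}"

text \<open>Irredundancy is expressed by witnesses satisfying strict inequalities: a point strictly inside, and for each
inequality a point at which it alone is tight. Such witnesses survive small changes of \<open>b\<close>, and every
linear relation between the normals can be tested on them.\<close>

definition irredundant :: "'i set \<Rightarrow> ('i \<Rightarrow> 'a::euclidean_space) \<Rightarrow> ('i \<Rightarrow> real) \<Rightarrow> bool" where
  "irredundant I a b \<longleftrightarrow> finite I \<and> (\<exists>z. \<forall>i\<in>I. a i \<bullet> z < b i) \<and>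
     (\<forall>i\<in>I. \<exists>p. a i \<bullet> p = b i \<and> (\<forall>k\<in>I - {i}. a k \<bullet> p < b k))"

lemma irredundant_facet_point:
  assumes "irredundant I a b" "i \<in> I"
  obtains p where "a i \<bullet> p = b i" "\<forall>k\<in>I - {i}. a k \<bullet> p < b k"
  using assms unfolding irredundant_def by blast

lemma irredundant_normal_nonzero:
  assumes "irredundant I a b" "i \<in> I" shows "a i \<noteq> 0"
proof
  assume "a i = 0"
  moreover obtain z p where "a i \<bullet> z < b i" "a i \<bullet> p = b i"
    using assms unfolding irredundant_def by blast
  ultimately show False by simp
qed

lemma hpoly_Inter: "hpoly I a b = \<Inter> ((\<lambda>i. {x. a i \<bullet> x \<le> b i}) ` I)"
  by (auto simp: hpoly_def)

lemma polyhedron_hpoly: "finite I \<Longrightarrow> polyhedron (hpoly I a b)"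
  unfolding hpoly_Inter by (rule polyhedron_Inter) (auto simp: polyhedron_halfspace_le)

lemma closed_hpoly: "closed (hpoly I a b)"
  unfolding hpoly_Inter by (auto simp: closed_halfspace_le)

lemma convex_hpoly: "convex (hpoly I a b)"
  unfolding hpoly_Inter by (auto simp: convex_halfspace_le intro!: convex_Inter)

lemma strict_points_open:
  assumes "finite I" shows "open {x. \<forall>i\<in>I. a i \<bullet> x < b i}"
proof -
  have "{x. \<forall>i\<in>I. a i \<bullet> x < b i} = \<Inter> ((\<lambda>i. {x. a i \<bullet> x < b i}) ` I)" by auto
  then show ?thesis using assms by (auto intro!: open_INT open_halfspace_lt)
qed

lemma strict_point_interior:
  assumes "finite I" "\<forall>i\<in>I. a i \<bullet> z < b i"
  shows "z \<in> interior (hpoly I a b)"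
  using strict_points_open[OF assms(1), of a b] assms(2)
  by (intro interiorI[of "{x. \<forall>i\<in>I. a i \<bullet> x < b i}"]) (auto simp: hpoly_def intro: less_imp_le)

lemma hface_strict_point:
  assumes "i \<in> I" "a i \<bullet> p = b i" "\<forall>k\<in>I - {i}. a k \<bullet> p < b k"
  shows "p \<in> hface I a b i"
  using assms unfolding hface_def hpoly_def by simp (metis Diff_iff less_eq_real_def singletonD)

lemma hface_inj:
  assumes "irredundant I a b" shows "inj_on (hface I a b) I"
proof (rule inj_onI, rule ccontr)
  fix i j assume ij: "i \<in> I" "j \<in> I" "hface I a b i = hface I a b j" "i \<noteq> j"
  obtain p where p: "a i \<bullet> p = b i" "\<forall>k\<in>I - {i}. a k \<bullet> p < b k"
    using irredundant_facet_point[OF assms ij(1)] .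
  have "p \<in> hface I a b i" by (rule hface_strict_point[OF ij(1) p])
  then have "p \<in> hface I a b j" by (simp only: ij(3))
  then have "a j \<bullet> p = b j" by (simp add: hface_def)
  then show False using p ij by force
qed

text \<open>A point slightly beyond the witness of the \<open>i\<close>-th inequality violates this inequality and no other one, so
that no halfspace can be omitted. For such a minimal family the facets are the tight sets of its members.\<close>

lemma facet_of_hpoly:
  assumes irr: "irredundant I a b"
  shows "{C. C facet_of hpoly I a b} = hface I a b ` I"
proof -
  define H where "H i = {x. a i \<bullet> x \<le> b i}" for i
  have fin: "finite I" using irr by (simp add: irredundant_def)
  obtain z where z: "\<forall>i\<in>I. a i \<bullet> z < b i" using irr by (auto simp: irredundant_def)
  have sep: "\<exists>x. x \<notin> H i \<and> (\<forall>k\<in>I - {i}. x \<in> H k)" if i: "i \<in> I" for i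
  proof -
    obtain p where p: "a i \<bullet> p = b i" "\<forall>k\<in>I - {i}. a k \<bullet> p < b k"
      using irr i unfolding irredundant_def by blast
    have "open {x. \<forall>k\<in>I - {i}. a k \<bullet> x < b k}" using strict_points_open fin by blast
    then obtain e where e: "e > 0" "ball p e \<subseteq> {x. \<forall>k\<in>I - {i}. a k \<bullet> x < b k}"
      using p(2) open_contains_ball by blast
    have nz: "a i \<noteq> 0" using irredundant_normal_nonzero[OF irr i] .
    define x where "x = p + (e / (2 * norm (a i))) *\<^sub>R a i"
    have "x \<in> ball p e" using e nz by (simp add: x_def dist_norm)
    moreover have "a i \<bullet> x > b i" using p e nz by (simp add: x_def inner_add_right)
    moreover have "a k \<bullet> x < b k" if "k \<in> I - {i}" for k
      using that \<open>x \<in> ball p e\<close> e(2) by blast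
    ultimately show ?thesis unfolding H_def
      by (intro exI[of _ x]) (auto intro: less_imp_le)
  qed
  have injH: "inj_on H I"
  proof (rule inj_onI, rule ccontr)
    fix i j assume "i \<in> I" "j \<in> I" "H i = H j" "i \<noteq> j"
    then show False using sep[of i] by auto
  qed
  define J where "J = inv_into I H"
  have J: "J (H i) = i" if "i \<in> I" for i using that injH by (simp add: J_def)
  have ah: "affine hull (hpoly I a b) = UNIV"
    using strict_point_interior[OF fin z] affine_hull_nonempty_interior by blast
  have "C facet_of hpoly I a b \<longleftrightarrow> (\<exists>h. h \<in> H ` I \<and> C = hpoly I a b \<inter> {x. a (J h) \<bullet> x = b (J h)})" for C
  proof (rule facet_of_polyhedron_explicit)
    show "finite (H ` I)" using fin by simp
    show "hpoly I a b = affine hull (hpoly I a b) \<inter> \<Inter> (H ` I)"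
      unfolding ah unfolding hpoly_def H_def by auto
    fix h assume "h \<in> H ` I"
    then obtain i where "i \<in> I" "h = H i" by blast
    then show "a (J h) \<noteq> 0 \<and> h = {x. a (J h) \<bullet> x \<le> b (J h)}"
      using J irredundant_normal_nonzero[OF irr] by (auto simp: H_def)
  next
    fix F' assume F': "F' \<subset> H ` I"
    then obtain i where i: "i \<in> I" "H i \<notin> F'" by blast
    obtain x where x: "x \<notin> H i" "\<forall>k\<in>I - {i}. x \<in> H k" using sep[OF i(1)] by blast
    have "x \<in> \<Inter>F'" using x i F' by blast
    moreover have "x \<notin> hpoly I a b" using x i by (auto simp: hpoly_def H_def)
    moreover have "hpoly I a b \<subseteq> \<Inter>F'" using F' by (auto simp: hpoly_def H_def)
    ultimately show "hpoly I a b \<subset> affine hull (hpoly I a b) \<inter> \<Inter>F'" unfolding ah by auto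
  qed
  then show ?thesis using J by (auto simp: hface_def)
qed

text \<open>In a minimal family of halfspaces, a witness for the member \<open>h\<close> is found on the segment from an interior
point of \<open>P\<close> to a point that violates \<open>h\<close> alone, where the segment crosses the boundary of \<open>h\<close>.\<close>

lemma exists_irredundant_representation:
  fixes P :: "'a::euclidean_space set"
  assumes "polyhedron P" "interior P \<noteq> {}"
  obtains I :: "'a set set" and a b where "irredundant I a b" "P = hpoly I a b"
proof -
  have ah: "affine hull P = UNIV" using affine_hull_nonempty_interior assms by blast
  obtain F where F: "finite F" "P = \<Inter>F" "\<forall>h\<in>F. \<exists>a b. a \<noteq> 0 \<and> h = {x. a \<bullet> x \<le> b}"
      "\<forall>F'. F' \<subset> F \<longrightarrow> P \<subset> \<Inter>F'"
    using assms(1) unfolding polyhedron_Int_affine_minimal ah by auto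
  then obtain a b where ab: "\<And>h. h \<in> F \<Longrightarrow> a h \<noteq> (0::'a) \<and> h = {x. a h \<bullet> x \<le> (b h :: real)}" by metis
  obtain z where z: "z \<in> interior P" using assms by blast
  have zs: "a h \<bullet> z < b h" if "h \<in> F" for h
  proof -
    have "z \<in> interior h" using z F(2) that interior_mono[of P h] by blast
    then show ?thesis using ab[OF that] interior_halfspace_le by (metis mem_Collect_eq)
  qed
  have "\<exists>p. a h \<bullet> p = b h \<and> (\<forall>k\<in>F - {h}. a k \<bullet> p < b k)" if h: "h \<in> F" for h
  proof -
    have "P \<subset> \<Inter>(F - {h})" using F(4) h by blast
    then obtain x where x: "x \<in> \<Inter>(F - {h})" "x \<notin> P" by blast
    then have "x \<notin> h" using F(2) by auto
    then have xh: "a h \<bullet> x > b h" using ab[OF h] by (metis mem_Collect_eq not_le)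
    have xk: "a k \<bullet> x \<le> b k" if "k \<in> F - {h}" for k
      using x that ab[of k] by blast
    define t where "t = (b h - a h \<bullet> z) / (a h \<bullet> x - a h \<bullet> z)"
    have t: "0 < t" "t < 1" using xh zs[OF h] by (auto simp: t_def)
    define p where "p = z + t *\<^sub>R (x - z)"
    have "a h \<bullet> p = a h \<bullet> z + t * (a h \<bullet> x - a h \<bullet> z)"
      by (simp add: p_def inner_add_right inner_diff_right)
    also have "\<dots> = b h" using xh zs[OF h] by (simp add: t_def)
    finally have 1: "a h \<bullet> p = b h" .
    have 2: "a k \<bullet> p < b k" if k: "k \<in> F - {h}" for k
    proof -
      have "a k \<bullet> p = (1 - t) * (a k \<bullet> z) + t * (a k \<bullet> x)"
        by (simp add: p_def inner_add_right inner_diff_right algebra_simps)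
      also have "\<dots> < (1 - t) * b k + t * b k"
        using t xk[OF k] zs[of k] k by (intro add_less_le_mono mult_left_mono mult_strict_left_mono) auto
      finally show ?thesis by (simp add: algebra_simps)
    qed
    from 1 2 show ?thesis by blast
  qed
  then have "irredundant F a b" using F(1) zs unfolding irredundant_def by blast
  moreover have "P = hpoly F a b" using F(2) ab unfolding hpoly_def by blast
  ultimately show ?thesis using that by blast
qed

text \<open>Evaluated at the witness of the facet \<open>i\<close>, a linear relation between the three normals loses the term of
\<open>i\<close>, and the slacks of the other two are positive. Hence the coefficients of \<open>j\<close> and \<open>k\<close> have
opposite signs or both vanish. The same holds for every pair, and three nonzero numbers cannot have
pairwise opposite signs.\<close>

lemma three_normals_independent:
  assumes irr: "irredundant I a b" and ijk: "i \<in> I" "j \<in> I" "k \<in> I" "i \<noteq> j" "i \<noteq> k" "j \<noteq> k"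
    and x: "a i \<bullet> x = b i" "a j \<bullet> x = b j" "a k \<bullet> x = b k"
    and dep: "\<alpha> *\<^sub>R a i + \<beta> *\<^sub>R a j + \<gamma> *\<^sub>R a k = 0"
  shows "\<alpha> = 0 \<and> \<beta> = 0 \<and> \<gamma> = 0"
proof -
  obtain z where z: "a i \<bullet> z < b i" "a j \<bullet> z < b j" "a k \<bullet> z < b k"
    using irr ijk by (auto simp: irredundant_def)
  obtain p where p: "a i \<bullet> p = b i" "a j \<bullet> p < b j" "a k \<bullet> p < b k"
    using irr ijk unfolding irredundant_def by (metis Diff_iff singletonD)
  obtain q where q: "a i \<bullet> q < b i" "a j \<bullet> q = b j" "a k \<bullet> q < b k"
    using irr ijk unfolding irredundant_def by (metis Diff_iff singletonD)
  obtain r where r: "a i \<bullet> r < b i" "a j \<bullet> r < b j" "a k \<bullet> r = b k"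
    using irr ijk unfolding irredundant_def by (metis Diff_iff singletonD)
  have lin: "\<alpha> * (b i - a i \<bullet> y) + \<beta> * (b j - a j \<bullet> y) + \<gamma> * (b k - a k \<bullet> y) = 0" for y
  proof -
    have "(\<alpha> *\<^sub>R a i + \<beta> *\<^sub>R a j + \<gamma> *\<^sub>R a k) \<bullet> (x - y) = 0" using dep by simp
    then show ?thesis by (simp add: inner_add_left inner_diff_right x algebra_simps)
  qed
  have sgn: "\<beta> * \<gamma> \<le> 0 \<and> (\<beta> = 0 \<longleftrightarrow> \<gamma> = 0)" if "\<beta> * B + \<gamma> * C = 0" "B > 0" "C > 0" for B C \<beta> \<gamma> :: real
  proof -
    define r where "r = C / B"
    have "r > 0" "\<beta> = - (r * \<gamma>)" using that by (auto simp: r_def field_simps)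
    then show ?thesis by (simp add: mult.assoc zero_le_mult_iff linorder_linear)
  qed
  have "\<beta> * \<gamma> \<le> 0 \<and> (\<beta> = 0 \<longleftrightarrow> \<gamma> = 0)" "\<alpha> * \<gamma> \<le> 0 \<and> (\<alpha> = 0 \<longleftrightarrow> \<gamma> = 0)" "\<alpha> * \<beta> \<le> 0 \<and> (\<alpha> = 0 \<longleftrightarrow> \<beta> = 0)"
    using lin[of p] p sgn[of \<beta> "b j - a j \<bullet> p" \<gamma> "b k - a k \<bullet> p"]
      lin[of q] q sgn[of \<alpha> "b i - a i \<bullet> q" \<gamma> "b k - a k \<bullet> q"]
      lin[of r] r sgn[of \<alpha> "b i - a i \<bullet> r" \<beta> "b j - a j \<bullet> r"] by simp_all
  then show ?thesis
    by (smt (verit) mult_pos_pos mult_neg_neg)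
qed

section \<open>Facets, edges and vertices in dimension three\<close>

lemma triple_independent:
  fixes u v w :: "real^3"
  assumes "\<And>\<alpha> \<beta> \<gamma>. \<alpha> *\<^sub>R u + \<beta> *\<^sub>R v + \<gamma> *\<^sub>R w = 0 \<Longrightarrow> \<alpha> = 0 \<and> \<beta> = 0 \<and> \<gamma> = 0"
  shows "independent {u, v, w}" "card {u, v, w} = 3" "span {u, v, w} = UNIV"
proof -
  have "u \<noteq> v" using assms[of 1 "-1" 0] by auto
  moreover have "u \<noteq> w" using assms[of 1 0 "-1"] by auto
  moreover have "v \<noteq> w" using assms[of 0 1 "-1"] by auto
  ultimately show c: "card {u, v, w} = 3" by simp
  have "w \<noteq> 0" using assms[of 0 0 1] by auto
  moreover have "v \<notin> span {w}"
  proof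
    assume "v \<in> span {w}"
    then obtain k where "v = k *\<^sub>R w" by (auto simp: span_singleton)
    then show False using assms[of 0 1 "-k"] by simp
  qed
  moreover have "u \<notin> span {v, w}"
  proof
    assume "u \<in> span {v, w}"
    then obtain k l where "u - k *\<^sub>R v = l *\<^sub>R w" by (auto simp: span_breakdown_eq span_singleton)
    then have "1 *\<^sub>R u + (-k) *\<^sub>R v + (-l) *\<^sub>R w = 0" by (simp add: algebra_simps)
    then show False using assms[of 1 "-k" "-l"] by simp
  qed
  ultimately show i: "independent {u, v, w}"
    by (intro independent_insertI) (auto simp: independent_empty)
  show "span {u, v, w} = UNIV"
    using c dim_eq_card_independent[OF i] dim_eq_full[of "{u,v,w}"] by simp
qed

lemma orthogonal_to_span_UNIV:
  assumes "span S = UNIV" "\<And>y. y \<in> S \<Longrightarrow> y \<bullet> d = 0" shows "d = 0"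
proof -
  have "orthogonal d d"
    using assms by (intro orthogonal_to_span[of d S]) (auto simp: orthogonal_def inner_commute)
  then show ?thesis by (simp add: orthogonal_def)
qed

text \<open>In dimension three, already three facets through a point determine it. This is why one of four facets
through a vertex can be moved away while the point stays a vertex of the rest.\<close>

lemma three_active_span:
  fixes a :: "'i \<Rightarrow> real^3"
  assumes irr: "irredundant I a b" and ijk: "i \<in> I" "j \<in> I" "k \<in> I" "i \<noteq> j" "i \<noteq> k" "j \<noteq> k"
    and x: "a i \<bullet> x = b i" "a j \<bullet> x = b j" "a k \<bullet> x = b k"
  shows "independent {a i, a j, a k}" "card {a i, a j, a k} = 3" "span {a i, a j, a k} = UNIV"
  by (rule triple_independent; rule three_normals_independent[OF irr ijk x]; assumption)+

lemma hface_face: "hface I a b i face_of hpoly I a b" if "i \<in> I"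
proof -
  have "hface I a b i = hpoly I a b \<inter> {x. a i \<bullet> x = b i}" by (auto simp: hface_def)
  moreover have "\<dots> face_of hpoly I a b"
    using that by (intro face_of_Int_supporting_hyperplane_le convex_hpoly) (auto simp: hpoly_def)
  ultimately show ?thesis by simp
qed

lemma aff_dim_hpoly:
  fixes a :: "'i \<Rightarrow> real^3"
  assumes "irredundant I a b" shows "aff_dim (hpoly I a b) = 3"
proof -
  obtain z where "z \<in> interior (hpoly I a b)"
    using assms strict_point_interior unfolding irredundant_def by blast
  then have "affine hull (hpoly I a b) = UNIV" using affine_hull_nonempty_interior by blast
  then show ?thesis using aff_dim_affine_hull[of "hpoly I a b"] by simp
qed

lemma aff_dim_hface:
  fixes a :: "'i \<Rightarrow> real^3"
  assumes "irredundant I a b" "i \<in> I" shows "aff_dim (hface I a b i) = 2"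
proof -
  have "hface I a b i facet_of hpoly I a b" using facet_of_hpoly[OF assms(1)] assms(2) by blast
  then show ?thesis using aff_dim_hpoly[OF assms(1)] by (simp add: facet_of_def)
qed

text \<open>An edge is the intersection of the facets containing it; these cannot be fewer than two for reasons of
dimension, and three of them would meet in a single point.\<close>

lemma edge_in_two_facets:
  fixes a :: "'i \<Rightarrow> real^3"
  assumes irr: "irredundant I a b" and E: "E edge_of hpoly I a b"
  shows "card {i \<in> I. E \<subseteq> hface I a b i} = 2"
    and "E = \<Inter> (hface I a b ` {i \<in> I. E \<subseteq> hface I a b i})"
proof -
  let ?P = "hpoly I a b" and ?A = "{i \<in> I. E \<subseteq> hface I a b i}"
  have fin: "finite I" using irr by (simp add: irredundant_def)
  have E1: "E face_of ?P" "aff_dim E = 1" using E by (auto simp: edge_of_def)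
  then have "E \<noteq> {}" "E \<noteq> ?P" using aff_dim_hpoly[OF irr] by auto
  then have "E = \<Inter> {F. F facet_of ?P \<and> E \<subseteq> F}"
    using face_of_polyhedron[OF polyhedron_hpoly[OF fin] E1(1)] by blast
  moreover have "{F. F facet_of ?P \<and> E \<subseteq> F} = hface I a b ` ?A"
    using facet_of_hpoly[OF irr] by (simp add: set_eq_iff) blast
  ultimately show EI: "E = \<Inter> (hface I a b ` ?A)" by simp
  have "card ?A \<noteq> 0"
  proof
    assume "card ?A = 0"
    then have "?A = {}" using fin by simp
    have "E = UNIV" using EI unfolding \<open>?A = {}\<close> by simp
    then show False using E1(2) by simp
  qed
  moreover have "card ?A \<noteq> 1"
  proof
    assume "card ?A = 1"
    then obtain i where i: "?A = {i}" by (auto simp: card_1_singleton_iff)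
    have "E = hface I a b i" using EI unfolding i by simp
    moreover have "i \<in> I" using i by blast
    ultimately show False using aff_dim_hface[OF irr] E1(2) by auto
  qed
  moreover have "\<not> card ?A \<ge> 3"
  proof
    assume "card ?A \<ge> 3"
    then obtain T where "T \<subseteq> ?A" "card T = 3" by (meson obtain_subset_with_card_n)
    then obtain i j k where ijk: "{i, j, k} \<subseteq> ?A" "i \<noteq> j" "i \<noteq> k" "j \<noteq> k"
      by (auto simp: card_3_iff)
    obtain x y where xy: "x \<in> E" "y \<in> E" "x \<noteq> y"
    proof -
      have "\<not> (\<exists>x. E = {x})" using E1(2) by auto
      then show ?thesis using that \<open>E \<noteq> {}\<close> by blast
    qed
    have act: "a m \<bullet> x = b m" "a m \<bullet> y = b m" if "m \<in> {i, j, k}" for m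
      using that ijk(1) xy by (auto simp: hface_def subset_iff)
    have "span {a i, a j, a k} = UNIV"
      using three_active_span(3)[OF irr _ _ _ ijk(2-4), of x] act(1) ijk(1) by auto
    then have "x - y = 0"
      by (rule orthogonal_to_span_UNIV) (use act in \<open>auto simp: inner_diff_right\<close>)
    then show False using xy by simp
  qed
  ultimately show "card ?A = 2" by linarith
qed

lemma sides_of_hface:
  fixes a :: "'i \<Rightarrow> real^3"
  assumes irr: "irredundant I a b" and i: "i \<in> I"
  shows "{E. E facet_of hface I a b i} = {E. E edge_of hpoly I a b \<and> E \<subseteq> hface I a b i}"
proof -
  have "E \<noteq> {}" if "aff_dim E = 1" for E :: "(real^3) set" using that by auto
  moreover have "E face_of hface I a b i \<longleftrightarrow> E face_of hpoly I a b \<and> E \<subseteq> hface I a b i" for E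
    by (rule face_of_face[OF hface_face[OF i]])
  ultimately show ?thesis
    unfolding facet_of_def edge_of_def aff_dim_hface[OF irr i] by auto
qed

lemma polytope_hpoly:
  assumes "finite I" "bounded (hpoly I a b)" shows "polytope (hpoly I a b)"
  using assms polyhedron_hpoly polytope_eq_bounded_polyhedron by blast

lemma finite_edges: "polytope P \<Longrightarrow> finite {E. E edge_of P}"
  by (rule finite_subset[OF _ finite_polytope_faces[of P]]) (auto simp: edge_of_def)

text \<open>Double counting of incidences: the sides of a facet have twice its width in total, and every edge is a side
of two facets.\<close>

lemma edge_widths_eq_facet_widths:
  fixes a :: "'i \<Rightarrow> real^3"
  assumes irr: "irredundant I a b" and bd: "bounded (hpoly I a b)"
  shows "(\<Sum>E | E edge_of hpoly I a b. width u E) = (\<Sum>i\<in>I. width u (hface I a b i))"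
proof -
  let ?P = "hpoly I a b"
  have fin: "finite I" using irr by (simp add: irredundant_def)
  have pt: "polytope ?P" using polytope_hpoly[OF fin bd] .
  have "2 * (\<Sum>i\<in>I. width u (hface I a b i)) = (\<Sum>i\<in>I. \<Sum>E | E \<in> {E. E edge_of ?P} \<and> E \<subseteq> hface I a b i. width u E)"
    unfolding sum_distrib_left
  proof (rule sum.cong[OF refl])
    fix i assume i: "i \<in> I"
    have "polytope (hface I a b i)" using face_of_polytope_polytope[OF pt hface_face[OF i]] .
    from polygon_side_widths[OF this aff_dim_hface[OF irr i], of u]
    show "2 * width u (hface I a b i) = (\<Sum>E | E \<in> {E. E edge_of ?P} \<and> E \<subseteq> hface I a b i. width u E)"
      using sides_of_hface[OF irr i] by simp
  qed
  also have "\<dots> = (\<Sum>E | E edge_of ?P. \<Sum>i | i \<in> I \<and> E \<subseteq> hface I a b i. width u E)"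
    by (rule sum.swap_restrict[OF fin finite_edges[OF pt]])
  also have "\<dots> = (\<Sum>E | E edge_of ?P. 2 * width u E)"
    using edge_in_two_facets(1)[OF irr] by (intro sum.cong) auto
  finally show ?thesis by (simp add: sum_distrib_left[symmetric])
qed

section \<open>Crofton's formula for the total edge length\<close>

lemma diameter_closed_segment:
  fixes p q :: "'a::real_normed_vector"
  shows "diameter (closed_segment p q) = norm (p - q)"
proof (rule antisym)
  show "diameter (closed_segment p q) \<le> norm (p - q)"
  proof (rule diameter_le)
    fix x y assume "x \<in> closed_segment p q" "y \<in> closed_segment p q"
    then obtain s t where st: "0 \<le> s" "s \<le> 1" "0 \<le> t" "t \<le> 1"
        "x = (1 - s) *\<^sub>R p + s *\<^sub>R q" "y = (1 - t) *\<^sub>R p + t *\<^sub>R q"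
      unfolding in_segment by blast
    have "x - y = (t - s) *\<^sub>R (p - q)" unfolding st(5,6) by (simp add: algebra_simps)
    moreover have "\<bar>t - s\<bar> \<le> 1" using st by auto
    ultimately show "norm (x - y) \<le> norm (p - q)" by (simp add: mult_left_le_one_le)
  qed auto
  show "norm (p - q) \<le> diameter (closed_segment p q)"
    using diameter_bounded_bound[OF bounded_closed_segment, of p p q q] by (simp add: dist_norm)
qed

lemma width_closed_segment: "width u (closed_segment p q) = \<bar>u \<bullet> (p - q)\<bar>"
proof -
  have "(\<bullet>) u ` closed_segment p q = closed_segment (u \<bullet> p) (u \<bullet> q)"
    using closed_segment_linear_image[OF bounded_linear.linear[OF bounded_linear_inner_right], of u p q] by simp
  then show ?thesis by (simp add: width_def closed_segment_eq_real_ivl inner_diff_right)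
qed

text \<open>The integral of \<open>\<bar>u \<bullet> w\<bar>\<close> over the unit ball for a unit vector \<open>w\<close>; by rotation invariance, any
\<open>w\<close> in place of the first basis vector gives the same value.\<close>

definition crofton_const :: real where
  "crofton_const = integral (cball 0 1) (\<lambda>u::real^3. \<bar>u \<bullet> axis 1 1\<bar>)"

lemma continuous_absolutely_integrable_cball:
  fixes f :: "'a::euclidean_space \<Rightarrow> 'b::euclidean_space"
  assumes "continuous_on UNIV f" shows "f absolutely_integrable_on cball c r"
proof -
  obtain k where "cball c r \<subseteq> cbox (-k) k" using bounded_subset_cbox_symmetric bounded_cball by metis
  moreover have "f absolutely_integrable_on cbox (-k) k"
    using assms continuous_on_subset by (intro absolutely_integrable_continuous) blast
  ultimately show ?thesis by (rule set_integrable_subset[rotated 2]) simp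
qed

lemma orthogonal_image_integral:
  fixes g :: "real^3 \<Rightarrow> real" and f :: "real^3 \<Rightarrow> real^3"
  assumes f: "orthogonal_transformation f" and g: "continuous_on UNIV g"
  shows "integral (cball 0 1) (\<lambda>u. g (f u)) = integral (cball 0 1) g"
proof -
  \<comment> \<open>The linear substitution rule concerns vector-valued integrands, so real values are
    regarded as vectors of length one.\<close>
  let ?g = "\<lambda>u. vec (g u) :: real^1"
  have lin: "linear f" using f orthogonal_transformation_linear by blast
  have cvec: "continuous_on UNIV ?g"
    unfolding vec_def by (rule continuous_on_vec_lambda) (rule g)
  have ai: "?g absolutely_integrable_on cball 0 1"
    using continuous_absolutely_integrable_cball[OF cvec] .
  have cf: "continuous_on UNIV (\<lambda>u. ?g (f u))"
    by (rule continuous_on_compose2[OF cvec linear_continuous_on]) (use lin linear_conv_bounded_linear in auto)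
  have ai': "(\<lambda>u. ?g (f u)) absolutely_integrable_on cball 0 1"
    using continuous_absolutely_integrable_cball[OF cf] .
  have im: "f ` cball 0 1 = cball 0 1"
    using image_orthogonal_transformation_cball[OF f, of 0 1] linear_0[OF lin] by simp
  have det: "\<bar>det (matrix f)\<bar> = 1" using f orthogonal_transformation_det by blast
  have "integral (f ` cball 0 1) ?g = \<bar>det (matrix f)\<bar> *\<^sub>R integral (cball 0 1) (?g \<circ> f)"
    using integral_change_of_variables_linear[OF lin, where f = ?g and S = "cball 0 1"] ai im by simp
  then have "integral (cball 0 1) ?g = integral (cball 0 1) (\<lambda>u. ?g (f u))"
    by (simp add: im det o_def)
  then have "integral (cball 0 1) ?g $ 1 = integral (cball 0 1) (\<lambda>u. ?g (f u)) $ 1" by simp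
  then have "integral (cball 0 1) (\<lambda>u. ?g u $ 1) = integral (cball 0 1) (\<lambda>u. ?g (f u) $ 1)"
    using ai ai' set_lebesgue_integral_eq_integral(1)
    by (subst (1 2) integral_component_eq_cart) auto
  then show ?thesis by simp
qed

text \<open>A rotation takes \<open>w\<close> to a multiple of the first basis vector and preserves the ball.\<close>

lemma mean_projection_length:
  fixes w :: "real^3"
  shows "((\<lambda>u. \<bar>u \<bullet> w\<bar>) has_integral (crofton_const * norm w)) (cball 0 1)"
proof -
  let ?e = "axis 1 1 :: real^3"
  have "norm w = norm (norm w *\<^sub>R ?e)" by simp
  then obtain f where f: "orthogonal_transformation f" "f w = norm w *\<^sub>R ?e"
    using orthogonal_transformation_exists by blast
  have c: "continuous_on UNIV (\<lambda>u::real^3. \<bar>u \<bullet> x\<bar>)" for x by (intro continuous_intros)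
  have "u \<bullet> w = norm w * (f u \<bullet> ?e)" for u
    using f by (metis inner_scaleR_right orthogonal_transformation_def)
  then have "integral (cball 0 1) (\<lambda>u. \<bar>u \<bullet> w\<bar>) = integral (cball 0 1) (\<lambda>u. norm w * \<bar>f u \<bullet> ?e\<bar>)"
    by (simp add: abs_mult)
  also have "\<dots> = norm w * integral (cball 0 1) (\<lambda>u. \<bar>f u \<bullet> ?e\<bar>)" by simp
  also have "integral (cball 0 1) (\<lambda>u. \<bar>f u \<bullet> ?e\<bar>) = crofton_const"
    unfolding crofton_const_def using orthogonal_image_integral[OF f(1) c] .
  finally have "integral (cball 0 1) (\<lambda>u. \<bar>u \<bullet> w\<bar>) = crofton_const * norm w" by simp
  moreover have "(\<lambda>u. \<bar>u \<bullet> w\<bar>) integrable_on cball 0 1"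
    using continuous_absolutely_integrable_cball[OF c] set_lebesgue_integral_eq_integral(1) by blast
  ultimately show ?thesis by (simp add: has_integral_iff)
qed

text \<open>Crofton's formula in the form used below: averaging turns the width of an edge into its length, and the
edges have been exchanged for the facets. Unlike edges, the facets keep their identity when a facet plane is
moved, even if vertices of higher degree break up.\<close>

lemma crofton_facets:
  fixes a :: "'i \<Rightarrow> real^3"
  assumes irr: "irredundant I a b" and bd: "bounded (hpoly I a b)"
  shows "((\<lambda>u. \<Sum>i\<in>I. width u (hface I a b i)) has_integral
           crofton_const * total_edge_length (hpoly I a b)) (cball 0 1)"
proof -
  let ?P = "hpoly I a b"
  have pt: "polytope ?P" using polytope_hpoly irr bd by (auto simp: irredundant_def)
  have "((\<lambda>u. width u E) has_integral crofton_const * diameter E) (cball 0 1)" if E: "E edge_of ?P" for E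
  proof -
    have "polytope E" using E face_of_polytope_polytope[OF pt] by (auto simp: edge_of_def)
    moreover have "collinear E" "E \<noteq> {}" using E by (auto simp: collinear_aff_dim edge_of_def)
    ultimately obtain p q where "E = closed_segment p q"
      by (meson compact_convex_collinear_segment polytope_imp_compact polytope_imp_convex)
    then show ?thesis using mean_projection_length[of "p - q"]
      by (simp add: diameter_closed_segment width_closed_segment)
  qed
  then have "((\<lambda>u. \<Sum>E | E edge_of ?P. width u E) has_integral
      (\<Sum>E | E edge_of ?P. crofton_const * diameter E)) (cball 0 1)"
    by (intro has_integral_sum finite_edges[OF pt]) auto
  then show ?thesis
    unfolding edge_widths_eq_facet_widths[OF irr bd] total_edge_length_def by (simp add: sum_distrib_left)
qed

text \<open>The edges at \<open>v\<close> correspond to the pairs among the three facets through \<open>v\<close>: two of these facets meet in a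
set that contains, besides \<open>v\<close>, a further point in the direction along which the third inequality
becomes slack.\<close>

lemma degree_of_simple_vertex:
  fixes a :: "'i \<Rightarrow> real^3"
  assumes irr: "irredundant I a b" and v: "v \<in> hpoly I a b"
    and three: "card {i \<in> I. a i \<bullet> v = b i} = 3"
  shows "vertex_degree (hpoly I a b) v = 3"
proof -
  let ?P = "hpoly I a b" and ?h = "hface I a b" and ?act = "{i \<in> I. a i \<bullet> v = b i}"
  let ?A = "\<lambda>E. {i \<in> I. E \<subseteq> ?h i}"
  have fin: "finite I" using irr by (simp add: irredundant_def)
  have A_act: "?A E \<subseteq> ?act" if "v \<in> E" for E using that by (auto simp: hface_def)
  have pair: "\<Inter> (?h ` S) edge_of ?P \<and> ?A (\<Inter> (?h ` S)) = S \<and> v \<in> \<Inter> (?h ` S)"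
    if S: "S \<subseteq> ?act" "card S = 2" for S
  proof -
    obtain i j where ij: "S = {i, j}" "i \<noteq> j" using S(2) by (auto simp: card_2_iff)
    have "card (?act - S) = 1" using three S by (subst card_Diff_subset) (auto simp: finite_subset[OF S(1)] fin)
    then obtain k where k: "?act - S = {k}" by (auto simp: card_1_singleton_iff)
    have ijk: "i \<in> I" "j \<in> I" "k \<in> I" "i \<noteq> j" "i \<noteq> k" "j \<noteq> k"
      "a i \<bullet> v = b i" "a j \<bullet> v = b j" "a k \<bullet> v = b k" using S(1) ij k by auto
    have act: "?act = {i, j, k}" using S(1) k ij by auto
    let ?G = "?h i \<inter> ?h j"
    have G: "\<Inter> (?h ` S) = ?G" using ij by simp
    have vG: "v \<in> ?G" using v ijk by (simp add: hface_def)
    have GP: "?G face_of ?P" by (rule face_of_Int[OF hface_face[OF ijk(1)] hface_face[OF ijk(2)]])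
    have "dim {a i, a j} < DIM(real^3)"
      using dim_le_card'[of "{a i, a j}"] card_insert_le_m1[of 2 "{a j}" "a i"] by simp
    then obtain d0 where d0: "d0 \<noteq> 0" "\<And>y. y \<in> span {a i, a j} \<Longrightarrow> orthogonal d0 y"
      using orthogonal_to_subspace_exists by blast
    have d0ij: "a i \<bullet> d0 = 0" "a j \<bullet> d0 = 0"
    proof -
      have "orthogonal d0 (a i)" "orthogonal d0 (a j)" by (rule d0(2), simp add: span_base)+
      then show "a i \<bullet> d0 = 0" "a j \<bullet> d0 = 0" by (simp_all add: orthogonal_def inner_commute)
    qed
    have "a k \<bullet> d0 \<noteq> 0"
    proof
      assume "a k \<bullet> d0 = 0"
      then have "d0 = 0"
        using orthogonal_to_span_UNIV[OF three_active_span(3)[OF irr ijk]] d0ij by blast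
      then show False using d0(1) by simp
    qed
    then obtain d where d: "d \<noteq> 0" "a i \<bullet> d = 0" "a j \<bullet> d = 0" "a k \<bullet> d < 0"
    proof (cases "a k \<bullet> d0 < 0")
      case True then show ?thesis using that[of d0] d0 d0ij by blast
    next
      case False then show ?thesis using that[of "- d0"] d0 d0ij \<open>a k \<bullet> d0 \<noteq> 0\<close> by simp
    qed
    have "open {x. \<forall>m\<in>I - ?act. a m \<bullet> x < b m}" using strict_points_open fin by blast
    moreover have "v \<in> {x. \<forall>m\<in>I - ?act. a m \<bullet> x < b m}" using v by (auto simp: hpoly_def less_le)
    ultimately obtain e where e: "e > 0" "ball v e \<subseteq> {x. \<forall>m\<in>I - ?act. a m \<bullet> x < b m}"
      using open_contains_ball by blast
    define y where "y = v + (e / (2 * norm d)) *\<^sub>R d"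
    have "y \<in> ball v e" using e d by (simp add: y_def dist_norm)
    have "a m \<bullet> y \<le> b m" if "m \<in> I - ?act" for m using subsetD[OF e(2) \<open>y \<in> ball v e\<close>] that by (simp add: less_imp_le)
    moreover have "a m \<bullet> y \<le> b m" if "m \<in> ?act" for m
      using that e d ijk unfolding act by (auto simp: y_def inner_add_right mult_nonneg_nonpos divide_nonpos_nonneg)
    ultimately have "y \<in> ?P" by (auto simp: hpoly_def)
    then have yG: "y \<in> ?G" using d ijk by (simp add: hface_def y_def inner_add_right)
    have "y \<noteq> v" using d e by (simp add: y_def)
    have "aff_dim {v, y} \<le> aff_dim ?G" using vG yG by (intro aff_dim_subset) auto
    then have ge: "aff_dim ?G \<ge> 1" using \<open>y \<noteq> v\<close> by (simp add: aff_dim_2)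
    have "?G face_of ?h i" using GP face_of_face[OF hface_face[OF ijk(1)], of ?G] by simp
    moreover have "?G \<noteq> ?h i"
    proof
      assume "?G = ?h i"
      obtain p where p: "a i \<bullet> p = b i" "\<forall>k\<in>I - {i}. a k \<bullet> p < b k"
        using irredundant_facet_point[OF irr ijk(1)] .
      have "p \<in> ?h i" by (rule hface_strict_point[OF ijk(1) p])
      then have "a j \<bullet> p = b j" using \<open>?G = ?h i\<close> by (auto simp: hface_def)
      moreover have "a j \<bullet> p < b j" using p(2) ijk by simp
      ultimately show False by simp
    qed
    ultimately have "aff_dim ?G < 2"
      using face_of_aff_dim_lt[of "?h i" ?G] aff_dim_hface[OF irr ijk(1)]
        face_of_imp_convex[OF hface_face[OF ijk(1)] ] by auto
    then have edge: "?G edge_of ?P" using ge GP by (simp add: edge_of_def)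
    have "S \<subseteq> ?A ?G" using ij ijk by auto
    then have "?A ?G = S" using edge_in_two_facets(1)[OF irr edge] S(2) fin
      by (metis (no_types, lifting) card_subset_eq finite_subset mem_Collect_eq subsetI)
    then show ?thesis using edge vG unfolding G by simp
  qed
  have "bij_betw (\<lambda>S. \<Inter> (?h ` S)) {S. S \<subseteq> ?act \<and> card S = 2} {E. E edge_of ?P \<and> v \<in> E}"
  proof (rule bij_betw_byWitness[where f' = ?A])
    show "\<forall>S\<in>{S. S \<subseteq> ?act \<and> card S = 2}. ?A (\<Inter> (?h ` S)) = S" using pair by blast
    show "\<forall>E\<in>{E. E edge_of ?P \<and> v \<in> E}. \<Inter> (?h ` ?A E) = E"
      using edge_in_two_facets(2)[OF irr] by auto
    show "(\<lambda>S. \<Inter> (?h ` S)) ` {S. S \<subseteq> ?act \<and> card S = 2} \<subseteq> {E. E edge_of ?P \<and> v \<in> E}"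
      using pair by blast
    show "?A ` {E. E edge_of ?P \<and> v \<in> E} \<subseteq> {S. S \<subseteq> ?act \<and> card S = 2}"
      using edge_in_two_facets(1)[OF irr] A_act by blast
  qed
  then have "card {E. E edge_of ?P \<and> v \<in> E} = card {S. S \<subseteq> ?act \<and> card S = 2}"
    by (simp add: bij_betw_same_card)
  also have "\<dots> = 3 choose 2" using n_subsets[of ?act 2] three fin by simp
  finally show ?thesis by (simp add: vertex_degree_def choose_two)
qed

section \<open>Moving a facet plane\<close>

lemma eventually_perturbed_less:
  fixes x y c d :: real
  assumes "x < y" shows "\<forall>\<^sub>F t in nhds 0. x + t * c < y + t * d"
proof -
  have "((\<lambda>t. (y + t * d) - (x + t * c)) \<longlongrightarrow> (y + 0 * d) - (x + 0 * c)) (nhds 0)"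
    by (intro tendsto_intros filterlim_ident)
  then have "\<forall>\<^sub>F t in nhds 0. 0 < (y + t * d) - (x + t * c)"
    by (rule order_tendstoD) (use assms in simp)
  then show ?thesis by (auto elim: eventually_mono)
qed

lemma common_small_multiple:
  fixes c d :: "'i \<Rightarrow> real"
  assumes "finite J" "\<And>k. k \<in> J \<Longrightarrow> 0 < d k"
  obtains \<mu> where "\<mu> > 0" "\<And>k. k \<in> J \<Longrightarrow> \<mu> * c k \<le> d k"
proof -
  have "\<forall>\<^sub>F t in nhds 0. \<forall>k\<in>J. 0 + t * c k < d k + t * 0"
    using assms by (intro eventually_ball_finite ballI eventually_perturbed_less)
  then obtain e where e: "e > 0" "\<And>t. dist t 0 < e \<Longrightarrow> \<forall>k\<in>J. 0 + t * c k < d k + t * 0"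
    unfolding eventually_nhds_metric by blast
  show ?thesis using that[of "e / 2"] e(1) e(2)[of "e / 2"] by (auto simp: less_imp_le)
qed

text \<open>All witnesses persist by continuity, except that the one on the moved facet has to travel with its plane,
along the vector \<open>w i0\<close> normalised to raise the value of the inequality at unit speed.\<close>

lemma irredundant_shift:
  assumes irr: "irredundant I a b" and i0: "i0 \<in> I"
  shows "\<forall>\<^sub>F t in nhds 0. irredundant I a (b(i0 := b i0 + t))"
proof -
  have fin: "finite I" using irr by (simp add: irredundant_def)
  have split: "(b(i0 := b i0 + t)) k = b k + t * (if k = i0 then 1 else 0)" for k t by simp
  obtain z where z: "\<forall>i\<in>I. a i \<bullet> z < b i" using irr by (auto simp: irredundant_def)
  have 1: "\<forall>\<^sub>F t in nhds 0. \<forall>i\<in>I. a i \<bullet> z + t * 0 < b i + t * (if i = i0 then 1 else 0)"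
    using z fin by (intro eventually_ball_finite ballI eventually_perturbed_less) auto
  define w where "w i = (if i = i0 then (1 / (a i0 \<bullet> a i0)) *\<^sub>R a i0 else 0)" for i
  have w: "a i \<bullet> w i = (if i = i0 then 1 else 0)" for i
    using irredundant_normal_nonzero[OF irr i0] by (simp add: w_def)
  have "\<forall>i\<in>I. \<exists>p. a i \<bullet> p = b i \<and> (\<forall>k\<in>I - {i}. a k \<bullet> p < b k)"
    using irr by (simp add: irredundant_def)
  then obtain p where p: "\<And>i. i \<in> I \<Longrightarrow> a i \<bullet> p i = b i" "\<And>i k. i \<in> I \<Longrightarrow> k \<in> I - {i} \<Longrightarrow> a k \<bullet> p i < b k"
    by metis
  have 2: "\<forall>\<^sub>F t in nhds 0. \<forall>i\<in>I. \<forall>k\<in>I - {i}. a k \<bullet> p i + t * (a k \<bullet> w i) < b k + t * (if k = i0 then 1 else 0)"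
    using p fin by (intro eventually_ball_finite ballI eventually_perturbed_less) auto
  from 1 2 show ?thesis
  proof eventually_elim
    case (elim t)
    show ?case unfolding irredundant_def
    proof (intro conjI ballI)
      show "\<exists>z. \<forall>i\<in>I. a i \<bullet> z < (b(i0 := b i0 + t)) i"
        unfolding split using elim(1) by (intro exI[of _ z]) (simp only: mult_zero_right add_0_right)
      fix i assume i: "i \<in> I"
      show "\<exists>p. a i \<bullet> p = (b(i0 := b i0 + t)) i \<and> (\<forall>k\<in>I - {i}. a k \<bullet> p < (b(i0 := b i0 + t)) k)"
        unfolding split using elim(2) i p(1)[OF i] w[of i]
        by (intro exI[of _ "p i + t *\<^sub>R w i"]) (auto simp: inner_add_right)
    qed (rule fin)
  qed
qed

lemma dilation_into_hpoly:
  assumes "x \<in> hpoly I a b" "0 \<le> \<mu>" "\<And>k. k \<in> I \<Longrightarrow> \<mu> * (b k - a k \<bullet> z) \<le> b' k - a k \<bullet> z"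
  shows "z + \<mu> *\<^sub>R (x - z) \<in> hpoly I a b'"
proof -
  have "a k \<bullet> (z + \<mu> *\<^sub>R (x - z)) \<le> b' k" if k: "k \<in> I" for k
  proof -
    have "\<mu> * (a k \<bullet> x - a k \<bullet> z) \<le> \<mu> * (b k - a k \<bullet> z)"
      using assms(1,2) k by (intro mult_left_mono) (auto simp: hpoly_def)
    then show ?thesis using assms(3)[OF k] by (simp add: inner_add_right inner_diff_right)
  qed
  then show ?thesis by (simp add: hpoly_def)
qed

text \<open>A sufficiently strong contraction towards an interior point of \<open>hpoly I a b\<close> carries the other set into it.\<close>

lemma bounded_hpoly_shift:
  assumes irr: "irredundant I a b" and bd: "bounded (hpoly I a b)"
  shows "bounded (hpoly I a b')"
proof -
  have fin: "finite I" using irr by (simp add: irredundant_def)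
  obtain z where z: "\<forall>i\<in>I. a i \<bullet> z < b i" using irr by (auto simp: irredundant_def)
  obtain \<mu> where \<mu>: "\<mu> > 0" "\<And>k. k \<in> I \<Longrightarrow> \<mu> * (b' k - a k \<bullet> z) \<le> b k - a k \<bullet> z"
    using common_small_multiple[OF fin, of "\<lambda>k. b k - a k \<bullet> z" "\<lambda>k. b' k - a k \<bullet> z"] z by auto
  obtain B where B: "\<And>x. x \<in> hpoly I a b \<Longrightarrow> norm x \<le> B" using bd by (auto simp: bounded_iff)
  have "norm x \<le> norm z + (B + norm z) / \<mu>" if x: "x \<in> hpoly I a b'" for x
  proof -
    have "z + \<mu> *\<^sub>R (x - z) \<in> hpoly I a b" using dilation_into_hpoly[OF x, of \<mu> z b] \<mu> by simp
    then have "norm (z + \<mu> *\<^sub>R (x - z)) \<le> B" by (rule B)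
    then have "norm (\<mu> *\<^sub>R (x - z)) \<le> B + norm z"
      using norm_triangle_ineq4[of "z + \<mu> *\<^sub>R (x - z)" z] by simp
    then have "norm (x - z) \<le> (B + norm z) / \<mu>" using \<mu>(1) by (simp add: pos_le_divide_eq mult.commute del: scaleR_right_diff_distrib)
    then show ?thesis using norm_triangle_ineq[of z "x - z"] by simp
  qed
  then show ?thesis by (auto simp: bounded_iff)
qed

section \<open>Concavity of the edge length\<close>

lemma inner_Sup_attained:
  fixes K :: "'a::euclidean_space set"
  assumes "compact K" "convex K" "K \<noteq> {}"
  obtains x where "x \<in> K" "u \<bullet> x = Sup ((\<bullet>) u ` K)"
proof -
  have "Sup ((\<bullet>) u ` K) \<in> (\<bullet>) u ` K"
    using inner_image_compact_convex[OF assms, of u] by (metis atLeastAtMost_iff order_refl)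
  then show ?thesis using that by auto
qed

lemma inner_Inf_attained:
  fixes K :: "'a::euclidean_space set"
  assumes "compact K" "convex K" "K \<noteq> {}"
  obtains x where "x \<in> K" "u \<bullet> x = Inf ((\<bullet>) u ` K)"
proof -
  have "Inf ((\<bullet>) u ` K) \<in> (\<bullet>) u ` K"
    using inner_image_compact_convex[OF assms, of u] by (metis atLeastAtMost_iff order_refl)
  then show ?thesis using that by auto
qed

lemma inner_le_Sup:
  fixes K :: "'a::euclidean_space set"
  assumes "compact K" "convex K" "x \<in> K"
  shows "u \<bullet> x \<le> Sup ((\<bullet>) u ` K)" "Inf ((\<bullet>) u ` K) \<le> u \<bullet> x"
proof -
  have "u \<bullet> x \<in> {Inf ((\<bullet>) u ` K) .. Sup ((\<bullet>) u ` K)}"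
    using inner_image_compact_convex(1)[OF assms(1,2), of u] assms(3) by (metis empty_iff imageI)
  then show "u \<bullet> x \<le> Sup ((\<bullet>) u ` K)" "Inf ((\<bullet>) u ` K) \<le> u \<bullet> x" by auto
qed

text \<open>Halving the sum of two extremal points shows that widths are midpoint concave. If the maximum of \<open>u\<close> over
\<open>K1\<close> does not exceed its value at a point of \<open>K\<close>, while over \<open>K2\<close> it stays below that value by
\<open>\<eta>\<close>, the inequality has the slack \<open>\<eta>\<close>.\<close>

lemma width_midpoint:
  fixes K K1 K2 :: "'a::euclidean_space set"
  assumes K: "compact K" "convex K" and K1: "compact K1" "convex K1" "K1 \<noteq> {}"
    and K2: "compact K2" "convex K2" "K2 \<noteq> {}"
    and mid: "\<And>x y. x \<in> K1 \<Longrightarrow> y \<in> K2 \<Longrightarrow> (1/2) *\<^sub>R (x + y) \<in> K"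
  shows "width u K1 + width u K2 \<le> 2 * width u K"
    and "v \<in> K \<Longrightarrow> (\<And>x. x \<in> K1 \<Longrightarrow> u \<bullet> x \<le> u \<bullet> v) \<Longrightarrow> (\<And>x. x \<in> K2 \<Longrightarrow> u \<bullet> x \<le> u \<bullet> v - \<eta>)
      \<Longrightarrow> width u K1 + width u K2 \<le> 2 * width u K - \<eta>"
proof -
  let ?S = "\<lambda>K. Sup ((\<bullet>) u ` K)" and ?I = "\<lambda>K. Inf ((\<bullet>) u ` K)"
  obtain x1 where x1: "x1 \<in> K1" "u \<bullet> x1 = ?S K1" using inner_Sup_attained[OF K1] .
  obtain x2 where x2: "x2 \<in> K2" "u \<bullet> x2 = ?S K2" using inner_Sup_attained[OF K2] .
  obtain y1 where y1: "y1 \<in> K1" "u \<bullet> y1 = ?I K1" using inner_Inf_attained[OF K1] .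
  obtain y2 where y2: "y2 \<in> K2" "u \<bullet> y2 = ?I K2" using inner_Inf_attained[OF K2] .
  have S: "?S K1 + ?S K2 \<le> 2 * ?S K"
    using inner_le_Sup(1)[OF K mid[OF x1(1) x2(1)], of u] x1 x2 by (simp add: inner_add_right)
  have I: "2 * ?I K \<le> ?I K1 + ?I K2"
    using inner_le_Sup(2)[OF K mid[OF y1(1) y2(1)], of u] y1 y2 by (simp add: inner_add_right)
  show "width u K1 + width u K2 \<le> 2 * width u K" using S I by (simp add: width_def)
  assume "v \<in> K" "\<And>x. x \<in> K1 \<Longrightarrow> u \<bullet> x \<le> u \<bullet> v" "\<And>x. x \<in> K2 \<Longrightarrow> u \<bullet> x \<le> u \<bullet> v - \<eta>"
  then have "?S K1 + ?S K2 \<le> 2 * ?S K - \<eta>"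
    using inner_le_Sup(1)[OF K, of v u] x1 x2 by fastforce
  then show "width u K1 + width u K2 \<le> 2 * width u K - \<eta>" using I by (simp add: width_def)
qed

text \<open>The source of the concavity of the edge length: the defining (in)equalities of a facet depend affinely on \<open>b\<close>.\<close>

lemma hface_midpoint:
  assumes "x \<in> hface I a (b(i0 := b i0 + s)) i" "y \<in> hface I a (b(i0 := b i0 + - s)) i"
  shows "(1/2) *\<^sub>R (x + y) \<in> hface I a b i"
proof -
  have x: "a k \<bullet> x \<le> (b(i0 := b i0 + s)) k" and y: "a k \<bullet> y \<le> (b(i0 := b i0 + - s)) k" if "k \<in> I" for k
    using assms that unfolding hface_def hpoly_def by blast+
  have "a k \<bullet> x + a k \<bullet> y \<le> 2 * b k" if "k \<in> I" for k
    using x[OF that] y[OF that] by (cases "k = i0") auto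
  moreover have "a i \<bullet> x + a i \<bullet> y = 2 * b i"
    using assms by (cases "i = i0") (auto simp: hface_def)
  ultimately show ?thesis by (simp add: hface_def hpoly_def inner_add_right mult.commute)
qed

lemma hface_body:
  assumes "irredundant I a b" "bounded (hpoly I a b)" "i \<in> I"
  shows "compact (hface I a b i)" "convex (hface I a b i)" "hface I a b i \<noteq> {}"
proof -
  have f: "hface I a b i face_of hpoly I a b" using hface_face[OF assms(3)] .
  have "compact (hpoly I a b)" using assms(2) closed_hpoly compact_eq_bounded_closed by blast
  then show "compact (hface I a b i)" by (rule face_of_imp_compact[OF convex_hpoly _ f])
  show "convex (hface I a b i)" using f by (rule face_of_imp_convex)
  obtain p where p: "a i \<bullet> p = b i" "\<forall>k\<in>I - {i}. a k \<bullet> p < b k"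
    using irredundant_facet_point[OF assms(1,3)] .
  have "p \<in> hface I a b i" by (rule hface_strict_point[OF assms(3) p])
  then show "hface I a b i \<noteq> {}" by blast
qed

text \<open>The vectors with nonpositive inner product against every \<open>d\<close> that satisfies the three inequalities contain
the simplex spanned by \<open>0, u, v, w\<close>. They form a convex cone, which therefore has interior points, and a
small ball inside it stays in the cone after a shift by \<open>- \<epsilon> *\<^sub>R n\<close>. The ball will consist of directions
for which the facet with normal \<open>n\<close> loses width at rate \<open>\<epsilon>\<close> when it is moved inwards.\<close>

lemma normal_cone_ball:
  fixes u v w :: "real^3" and n :: "real^3"
  assumes ind: "independent {u, v, w}" "card {u, v, w} = 3"
  obtains c r \<epsilon> where "r > 0" "\<epsilon> > 0" "ball c r \<subseteq> cball 0 1"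
    "\<forall>x\<in>ball c r. \<forall>d. u \<bullet> d \<le> 0 \<longrightarrow> v \<bullet> d \<le> 0 \<longrightarrow> w \<bullet> d \<le> 0 \<longrightarrow> x \<bullet> d \<le> 0 \<and> x \<bullet> d \<le> \<epsilon> * (n \<bullet> d)"
proof -
  define N where "N = {x. \<forall>d. u \<bullet> d \<le> 0 \<longrightarrow> v \<bullet> d \<le> 0 \<longrightarrow> w \<bullet> d \<le> 0 \<longrightarrow> x \<bullet> d \<le> 0}"
  have "convex N" unfolding convex_def N_def
    by (auto simp: inner_add_left intro!: add_nonpos_nonpos mult_nonneg_nonpos)
  then have hull: "convex hull (insert 0 {u, v, w}) \<subseteq> N"
    by (intro hull_minimal) (auto simp: N_def)
  obtain a where "a \<in> interior (convex hull (insert 0 {u, v, w}))"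
    using interior_simplex_nonempty[OF ind(1)] ind(2) by auto
  then obtain e where e: "e > 0" "ball a e \<subseteq> N"
    using hull by (meson mem_interior order_trans)
  \<comment> \<open>rescaling by this factor puts the ball around \<open>a\<close> of radius \<open>e\<close> into the unit ball\<close>
  define k where "k = 1 / (norm a + e)"
  have k: "k > 0" using e by (simp add: k_def add_nonneg_pos)
  have kb: "x \<in> N \<and> norm x < 1" if "norm (x - k *\<^sub>R a) < k * e" for x
  proof -
    have "norm ((1/k) *\<^sub>R (x - k *\<^sub>R a)) = norm (x - k *\<^sub>R a) / k" using k by simp
    also have "\<dots> < e" using that k by (simp add: pos_divide_less_eq mult.commute)
    finally have "norm ((1/k) *\<^sub>R (x - k *\<^sub>R a)) < e" .
    moreover have "(1/k) *\<^sub>R (x - k *\<^sub>R a) = (1/k) *\<^sub>R x - a" using k by (simp add: algebra_simps)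
    ultimately have "(1/k) *\<^sub>R x \<in> N" using e(2) by (auto simp: dist_norm norm_minus_commute)
    then have "x \<in> N" using k by (auto simp: N_def divide_le_0_iff)
    moreover have "norm x \<le> norm (k *\<^sub>R a) + norm (x - k *\<^sub>R a)"
      using norm_triangle_ineq[of "k *\<^sub>R a" "x - k *\<^sub>R a"] by simp
    moreover have "norm (k *\<^sub>R a) + k * e = 1" 
    proof -
      have "norm (k *\<^sub>R a) + k * e = k * (norm a + e)" using k by (simp add: algebra_simps)
      also have "\<dots> = 1" using e by (simp add: k_def add_nonneg_eq_0_iff)
      finally show ?thesis .
    qed
    ultimately show ?thesis using that by linarith
  qed
  define \<epsilon> where "\<epsilon> = k * e / (2 * (norm n + 1))"
  have eps: "\<epsilon> > 0" unfolding \<epsilon>_def using k e by (simp add: add_nonneg_pos)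
  have "\<epsilon> * norm n \<le> \<epsilon> * (norm n + 1)" using eps by simp
  also have "\<dots> = k * e / 2" 
  proof -
    have "norm n + 1 \<noteq> 0" using norm_ge_zero[of n] by linarith
    then show ?thesis by (simp add: \<epsilon>_def divide_simps)
  qed
  finally have en: "\<epsilon> * norm n \<le> k * e / 2" .
  have in1: "x \<in> N" "norm x < 1" "x - \<epsilon> *\<^sub>R n \<in> N" if "x \<in> ball (k *\<^sub>R a) (k * e / 2)" for x
  proof -
    have d: "norm (x - k *\<^sub>R a) < k * e / 2" using that by (simp add: dist_norm norm_minus_commute)
    have ke: "k * e > 0" using k e by simp
    then show "x \<in> N" "norm x < 1" using kb[of x] d by auto
    have "norm (x - \<epsilon> *\<^sub>R n - k *\<^sub>R a) \<le> norm (x - k *\<^sub>R a) + norm (\<epsilon> *\<^sub>R n)"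
      using norm_triangle_ineq4[of "x - k *\<^sub>R a" "\<epsilon> *\<^sub>R n"] by (simp add: algebra_simps)
    also have "\<dots> < k * e" using d en eps by simp
    finally show "x - \<epsilon> *\<^sub>R n \<in> N" using kb by blast
  qed
  show ?thesis
  proof (rule that)
    show "k * e / 2 > 0" using k e by simp
    show "\<epsilon> > 0" by (rule eps)
    show "ball (k *\<^sub>R a) (k * e / 2) \<subseteq> cball 0 1" using in1(2) by (force simp: less_imp_le)
    show "\<forall>x\<in>ball (k *\<^sub>R a) (k * e / 2). \<forall>d. u \<bullet> d \<le> 0 \<longrightarrow> v \<bullet> d \<le> 0 \<longrightarrow> w \<bullet> d \<le> 0 \<longrightarrow>
        x \<bullet> d \<le> 0 \<and> x \<bullet> d \<le> \<epsilon> * (n \<bullet> d)"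
    proof (intro ballI allI impI)
      fix x d assume "x \<in> ball (k *\<^sub>R a) (k * e / 2)" and d: "u \<bullet> d \<le> 0" "v \<bullet> d \<le> 0" "w \<bullet> d \<le> 0"
      then have "x \<in> N" "x - \<epsilon> *\<^sub>R n \<in> N" using in1 by blast+
      then have "x \<bullet> d \<le> 0" "(x - \<epsilon> *\<^sub>R n) \<bullet> d \<le> 0" using d unfolding N_def by blast+
      then show "x \<bullet> d \<le> 0 \<and> x \<bullet> d \<le> \<epsilon> * (n \<bullet> d)" by (simp add: inner_diff_left)
    qed
  qed
qed

lemma integral_indicator_ball:
  fixes c :: "'a::euclidean_space"
  assumes "ball c r \<subseteq> cball 0 1"
  shows "((\<lambda>u. if u \<in> ball c r then k else 0) has_integral k * measure lebesgue (ball c r)) (cball 0 (1::real))"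
proof -
  have "ball c r \<in> lmeasurable" by simp
  then have "((\<lambda>_. 1::real) has_integral measure lebesgue (ball c r)) (ball c r)"
    using lmeasure_integral lmeasurable_iff_integrable_on by (metis has_integral_iff)
  from has_integral_mult_right[OF this, of k]
  have "((\<lambda>_. k) has_integral k * measure lebesgue (ball c r)) (ball c r)" by simp
  then show ?thesis using has_integral_restrict[OF assms, of "\<lambda>_. k"] by simp
qed

lemma crofton_const_pos: "crofton_const > 0"
proof -
  let ?e = "axis 1 1 :: real^3" 
  let ?B = "ball ((1/2) *\<^sub>R ?e) (1/4)"
  have n: "norm ?e = 1" by simp
  have pt: "1/4 \<le> u \<bullet> ?e \<and> norm u \<le> 1" if "u \<in> ?B" for u
  proof -
    have d: "norm (u - (1/2) *\<^sub>R ?e) < 1/4" using that by (simp add: dist_norm norm_minus_commute)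
    have "\<bar>(u - (1/2) *\<^sub>R ?e) \<bullet> ?e\<bar> \<le> norm (u - (1/2) *\<^sub>R ?e) * norm ?e" by (rule Cauchy_Schwarz_ineq2)
    then have "\<bar>u \<bullet> ?e - 1/2\<bar> < 1/4" using d n by (simp add: inner_diff_left dot_square_norm)
    moreover have "norm u \<le> norm ((1/2) *\<^sub>R ?e) + norm (u - (1/2) *\<^sub>R ?e)"
      using norm_triangle_ineq[of "(1/2) *\<^sub>R ?e" "u - (1/2) *\<^sub>R ?e"] by simp
    ultimately show ?thesis using d by (simp add: abs_if split: if_splits)
  qed
  then have sub: "?B \<subseteq> cball 0 1" by auto
  have "(1/4) * measure lebesgue ?B \<le> crofton_const * norm ?e"
    by (rule has_integral_le[OF integral_indicator_ball[OF sub] mean_projection_length]) (use pt in force)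
  moreover have "measure lebesgue ?B > 0" using content_ball_pos[of "1/4" "(1/2) *\<^sub>R ?e"] by simp
  ultimately show ?thesis unfolding n mult_1_right by linarith
qed

text \<open>By Crofton's formula it suffices to compare the facet widths direction by direction. Midpoint concavity gives
the inequality without the last term. For the gain, consider a direction \<open>u\<close> in the ball of the previous
lemma: the inequalities \<open>i\<close>, \<open>j\<close>, \<open>k\<close> alone force \<open>u \<bullet> x \<le> u \<bullet> v\<close>, so moving the
facet \<open>i0\<close> outwards does not raise the maximum of \<open>u\<close> on it, whereas moving it inwards lowers
this maximum by at least \<open>\<epsilon> * s\<close>.\<close>

lemma edge_length_concave_kink:
  fixes a :: "'i \<Rightarrow> real^3"
  assumes irr: "irredundant I a b" and bd: "bounded (hpoly I a b)"
    and I: "i0 \<in> I" "i \<in> I" "j \<in> I" "k \<in> I" "i \<noteq> j" "i \<noteq> k" "j \<noteq> k" "i0 \<notin> {i, j, k}"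
    and v: "v \<in> hpoly I a b" and act: "a i0 \<bullet> v = b i0" "a i \<bullet> v = b i" "a j \<bullet> v = b j" "a k \<bullet> v = b k"
  obtains \<kappa> where "\<kappa> > 0"
    "\<forall>\<^sub>F s in at_right 0. total_edge_length (hpoly I a (b(i0 := b i0 + s)))
        + total_edge_length (hpoly I a (b(i0 := b i0 - s))) \<le> 2 * total_edge_length (hpoly I a b) - \<kappa> * s"
proof -
  define bt where "bt t = b(i0 := b i0 + t)" for t
  let ?L = "\<lambda>t. total_edge_length (hpoly I a (bt t))"
  have fin: "finite I" using irr by (simp add: irredundant_def)
  obtain c r \<epsilon> where B: "r > 0" "\<epsilon> > 0" "ball c r \<subseteq> cball 0 1"
    and cone_all: "\<forall>x\<in>ball c r. \<forall>d. a i \<bullet> d \<le> 0 \<longrightarrow> a j \<bullet> d \<le> 0 \<longrightarrow> a k \<bullet> d \<le> 0 \<longrightarrow>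
        x \<bullet> d \<le> 0 \<and> x \<bullet> d \<le> \<epsilon> * (a i0 \<bullet> d)"
    using normal_cone_ball[OF three_active_span(1,2)[OF irr I(2-7) act(2-4)], of "a i0"] .
  have cone: "x \<bullet> d \<le> 0 \<and> x \<bullet> d \<le> \<epsilon> * (a i0 \<bullet> d)"
    if "x \<in> ball c r" "a i \<bullet> d \<le> 0" "a j \<bullet> d \<le> 0" "a k \<bullet> d \<le> 0" for x d
    using cone_all that by blast
  define \<kappa> where "\<kappa> = \<epsilon> * measure lebesgue (ball c r) / crofton_const"
  have "\<kappa> > 0" unfolding \<kappa>_def
    using B content_ball_pos[OF B(1), of c] crofton_const_pos by simp
  have "\<forall>\<^sub>F t in nhds 0. irredundant I a (bt t)" unfolding bt_def using irredundant_shift[OF irr I(1)] .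
  then obtain \<delta> where \<delta>: "\<delta> > 0" "\<And>t. \<bar>t\<bar> < \<delta> \<Longrightarrow> irredundant I a (bt t)"
    unfolding eventually_nhds_metric by (auto simp: dist_real_def)
  have main: "?L s + ?L (- s) \<le> 2 * total_edge_length (hpoly I a b) - \<kappa> * s" if s: "0 < s" "s < \<delta>" for s
  proof -
    let ?f = "\<lambda>t u. \<Sum>m\<in>I. width u (hface I a (bt t) m)"
    have irs: "irredundant I a (bt s)" "irredundant I a (bt (- s))" using \<delta> s by auto
    have bds: "bounded (hpoly I a (bt t))" for t using bounded_hpoly_shift[OF irr bd] .
    have b0: "bt 0 = b" by (simp add: bt_def)
    have pt: "?f s u + ?f (- s) u \<le> 2 * ?f 0 u - (if u \<in> ball c r then \<epsilon> * s else 0)" for u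
    proof -
      define g where "g = (if u \<in> ball c r then \<epsilon> * s else 0)"
      have le: "width u (hface I a (bt s) m) + width u (hface I a (bt (- s)) m) 
           \<le> 2 * width u (hface I a b m) - (if m = i0 then g else 0)" if m: "m \<in> I" for m
      proof -
        have "(1/2) *\<^sub>R (x + y) \<in> hface I a b m"
          if "x \<in> hface I a (bt s) m" "y \<in> hface I a (bt (- s)) m" for x y
          using that unfolding bt_def by (rule hface_midpoint)
        note wm = width_midpoint[OF hface_body(1,2)[OF irr bd m] hface_body[OF irs(1) bds m] hface_body[OF irs(2) bds m] this]
        show ?thesis
        proof (cases "m = i0 \<and> u \<in> ball c r")
          case False
          then show ?thesis using wm(1)[of u] by (auto simp: g_def)
        next
          case True
          have less: "a l \<bullet> (x - v) \<le> 0" if "x \<in> hpoly I a (bt t)" "l \<in> {i, j, k}" for x l t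
          proof -
            have "l \<in> I" "l \<noteq> i0" "a l \<bullet> v = b l" using that(2) I act by auto
            then show ?thesis using that(1) by (force simp: hpoly_def bt_def inner_diff_right)
          qed
          have "v \<in> hface I a b m" using v act True by (simp add: hface_def)
          moreover have "u \<bullet> x \<le> u \<bullet> v" if "x \<in> hface I a (bt s) m" for x
            using cone[of u "x - v"] less[of x s] that True by (simp add: hface_def inner_diff_right)
          moreover have "u \<bullet> x \<le> u \<bullet> v - \<epsilon> * s" if "x \<in> hface I a (bt (- s)) m" for x
          proof -
            have "a i0 \<bullet> (x - v) = - s" using that True act by (simp add: hface_def bt_def inner_diff_right)
            then show ?thesis
              using cone[of u "x - v"] less[of x "- s"] that True by (simp add: hface_def inner_diff_right)
          qed
          ultimately show ?thesis using wm(2)[of v u "\<epsilon> * s"] True by (simp add: g_def)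
        qed
      qed
      have "?f s u + ?f (- s) u \<le> (\<Sum>m\<in>I. 2 * width u (hface I a b m) - (if m = i0 then g else 0))"
        unfolding sum.distrib[symmetric] by (rule sum_mono) (rule le)
      also have "\<dots> = 2 * ?f 0 u - g"
        using fin I(1) by (simp add: sum_subtractf sum_distrib_left b0 sum.delta)
      finally show ?thesis unfolding g_def .
    qed
    have ir0: "irredundant I a (bt 0)" unfolding b0 by (rule irr)
    note cr = crofton_facets[OF irs(1) bds] crofton_facets[OF irs(2) bds] crofton_facets[OF ir0 bds]
    have "crofton_const * ?L s + crofton_const * ?L (- s) \<le>
        2 * (crofton_const * ?L 0) - (\<epsilon> * s) * measure lebesgue (ball c r)"
      by (rule has_integral_le[OF has_integral_add[OF cr(1,2)]
            has_integral_diff[OF has_integral_mult_right[OF cr(3)] integral_indicator_ball[OF B(3)]]])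
        (rule pt)
    moreover have "crofton_const * (2 * ?L 0 - \<kappa> * s) =
        2 * (crofton_const * ?L 0) - (\<epsilon> * s) * measure lebesgue (ball c r)"
      using crofton_const_pos by (simp add: \<kappa>_def right_diff_distrib)
    ultimately have "crofton_const * (?L s + ?L (- s)) \<le> crofton_const * (2 * ?L 0 - \<kappa> * s)"
      by (simp only: distrib_left)
    then show ?thesis using crofton_const_pos by (simp add: b0)
  qed
  show ?thesis
  proof (rule that[OF \<open>\<kappa> > 0\<close>])
    show "\<forall>\<^sub>F s in at_right 0. total_edge_length (hpoly I a (b(i0 := b i0 + s)))
        + total_edge_length (hpoly I a (b(i0 := b i0 - s))) \<le> 2 * total_edge_length (hpoly I a b) - \<kappa> * s"
      unfolding eventually_at_right_field using main \<delta>(1) unfolding bt_def by auto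
  qed
qed

section \<open>First-order behaviour of the volume\<close>

lemma compact_hpoly: "bounded (hpoly I a b) \<Longrightarrow> compact (hpoly I a b)"
  using closed_hpoly compact_eq_bounded_closed by blast

lemma one_minus_cube_ge:
  fixes y :: real
  assumes "0 \<le> y" "y \<le> 1" shows "(1 - y) ^ 3 \<ge> 1 - 3 * y"
proof -
  have "(1 - y) ^ 3 - (1 - 3 * y) = y\<^sup>2 * (3 - y)" by (simp add: power3_eq_cube power2_eq_square algebra_simps)
  also have "\<dots> \<ge> 0" using assms by simp
  finally show ?thesis by simp
qed

text \<open>The homothety with ratio \<open>1 - s / h\<close> about an interior point, whose slack in the moved inequality is \<open>h\<close>,
maps the polyhedron into the smaller one.\<close>

lemma volume_inward_shift:
  fixes a :: "'i \<Rightarrow> real^3"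
  assumes irr: "irredundant I a b" and bd: "bounded (hpoly I a b)" and i0: "i0 \<in> I"
  obtains K where "K > 0"
    "\<forall>\<^sub>F s in at_right 0. volume (hpoly I a b) * (1 - K * s) \<le> volume (hpoly I a (b(i0 := b i0 - s)))
       \<and> volume (hpoly I a (b(i0 := b i0 - s))) \<le> volume (hpoly I a b)"
proof -
  obtain z where z: "\<forall>i\<in>I. a i \<bullet> z < b i" using irr by (auto simp: irredundant_def)
  define h where "h = b i0 - a i0 \<bullet> z"
  have h: "h > 0" using z i0 by (simp add: h_def)
  have main: "volume (hpoly I a b) * (1 - (3 / h) * s) \<le> volume (hpoly I a (b(i0 := b i0 - s)))
       \<and> volume (hpoly I a (b(i0 := b i0 - s))) \<le> volume (hpoly I a b)" if s: "0 < s" "s < h" for s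
  proof -
    let ?Q = "hpoly I a (b(i0 := b i0 - s))" and ?P = "hpoly I a b"
    have meas: "?Q \<in> lmeasurable" "?P \<in> lmeasurable"
      using bounded_hpoly_shift[OF irr bd] by (auto intro!: lmeasurable_compact compact_hpoly)
    have sub: "?Q \<subseteq> ?P"
    proof
      fix x assume x: "x \<in> ?Q"
      have "a k \<bullet> x \<le> b k" if "k \<in> I" for k
        using x that s by (cases "k = i0") (force simp: hpoly_def)+
      then show "x \<in> ?P" by (simp add: hpoly_def)
    qed
    define \<mu> where "\<mu> = 1 - s / h"
    have \<mu>: "0 \<le> \<mu>" "\<mu> \<le> 1" using s h by (auto simp: \<mu>_def)
    have "(\<lambda>x. \<mu> *\<^sub>R x + (1 - \<mu>) *\<^sub>R z) ` ?P \<subseteq> ?Q"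
    proof
      fix y assume "y \<in> (\<lambda>x. \<mu> *\<^sub>R x + (1 - \<mu>) *\<^sub>R z) ` ?P"
      then obtain x where x: "x \<in> ?P" "y = z + \<mu> *\<^sub>R (x - z)" by (auto simp: algebra_simps)
      have "\<mu> * (b k - a k \<bullet> z) \<le> (b(i0 := b i0 - s)) k - a k \<bullet> z" if "k \<in> I" for k
      proof (cases "k = i0")
        case True
        have "\<mu> * h = h - s" using h by (simp add: \<mu>_def field_simps)
        then show ?thesis using True by (simp add: h_def)
      next
        case False
        then show ?thesis using that z \<mu> mult_right_mono[of \<mu> 1 "b k - a k \<bullet> z"] by simp
      qed
      then show "y \<in> ?Q" using dilation_into_hpoly[OF x(1) \<mu>(1)] x(2) by blast
    qed
    moreover have "(\<lambda>x. \<mu> *\<^sub>R x + (1 - \<mu>) *\<^sub>R z) ` ?P \<in> lmeasurable"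
      by (intro lmeasurable_compact compact_continuous_image continuous_intros compact_hpoly bd)
    ultimately have "measure lebesgue ((\<lambda>x. \<mu> *\<^sub>R x + (1 - \<mu>) *\<^sub>R z) ` ?P) \<le> measure lebesgue ?Q"
      using meas by (intro measure_mono_fmeasurable) auto
    then have "\<mu> ^ 3 * measure lebesgue ?P \<le> measure lebesgue ?Q"
      using \<mu> by (simp add: measure_lebesgue_affine)
    moreover have "(1 - (3 / h) * s) * measure lebesgue ?P \<le> \<mu> ^ 3 * measure lebesgue ?P"
      using one_minus_cube_ge[of "s / h"] s h by (intro mult_right_mono) (auto simp: \<mu>_def)
    moreover have "measure lebesgue ?Q \<le> measure lebesgue ?P"
      using sub meas by (intro measure_mono_fmeasurable) auto
    ultimately show ?thesis by (simp add: volume_def mult.commute)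
  qed
  show ?thesis
  proof (rule that[of "3 / h"])
    show "3 / h > 0" using h by simp
    show "\<forall>\<^sub>F s in at_right 0. volume (hpoly I a b) * (1 - (3 / h) * s) \<le> volume (hpoly I a (b(i0 := b i0 - s)))
       \<and> volume (hpoly I a (b(i0 := b i0 - s))) \<le> volume (hpoly I a b)"
      unfolding eventually_at_right_field using main h by blast
  qed
qed

text \<open>To first order, the volume gained is at least the volume lost: the slab lost by moving the facet plane inwards
is mapped into the slab gained by moving it outwards. The map translates along the normal \<open>w\<close> of the facet, raising
the value of the moved inequality by \<open>s\<close>, and contracts about a relative interior point \<open>p\<close> of the facet, with ratio
\<open>1 - \<kappa> * s\<close>; the contraction makes up for the sideways part of the translation, because \<open>p\<close> has
positive slack in the other inequalities.\<close>

lemma volume_outward_shift: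
  fixes a :: "'i \<Rightarrow> real^3"
  assumes irr: "irredundant I a b" and bd: "bounded (hpoly I a b)" and i0: "i0 \<in> I"
  obtains K where "K > 0"
    "\<forall>\<^sub>F s in at_right 0. (1 - K * s) * (volume (hpoly I a b) - volume (hpoly I a (b(i0 := b i0 - s))))
       \<le> volume (hpoly I a (b(i0 := b i0 + s))) - volume (hpoly I a b)"
proof -
  have fin: "finite I" using irr by (simp add: irredundant_def)
  have nz: "a i0 \<noteq> 0" using irredundant_normal_nonzero[OF irr i0] .
  obtain p where p: "a i0 \<bullet> p = b i0" "\<forall>k\<in>I - {i0}. a k \<bullet> p < b k"
    using irredundant_facet_point[OF irr i0] .
  define w where "w = (1 / (a i0 \<bullet> a i0)) *\<^sub>R a i0"
  have w: "a i0 \<bullet> w = 1" using nz by (simp add: w_def)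
  obtain \<mu> where \<mu>: "\<mu> > 0" "\<And>k. k \<in> I - {i0} \<Longrightarrow> \<mu> * (a k \<bullet> w) \<le> b k - a k \<bullet> p"
    using common_small_multiple[of "I - {i0}" "\<lambda>k. b k - a k \<bullet> p" "\<lambda>k. a k \<bullet> w"] p fin by auto
  define \<kappa> where "\<kappa> = 1 / \<mu>"
  have \<kappa>: "\<kappa> > 0" "\<And>k. k \<in> I - {i0} \<Longrightarrow> a k \<bullet> w \<le> \<kappa> * (b k - a k \<bullet> p)"
    using \<mu> by (auto simp: \<kappa>_def field_simps)
  have main: "(1 - (3 * \<kappa>) * s) * (volume (hpoly I a b) - volume (hpoly I a (b(i0 := b i0 - s))))
       \<le> volume (hpoly I a (b(i0 := b i0 + s))) - volume (hpoly I a b)" if s: "0 < s" "s < 1 / \<kappa>" for s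
  proof -
    let ?M = "hpoly I a (b(i0 := b i0 - s))" and ?P = "hpoly I a b" and ?O = "hpoly I a (b(i0 := b i0 + s))"
    define r where "r = 1 - \<kappa> * s"
    have r: "0 < r" "r < 1" using s \<kappa>(1) by (auto simp: r_def field_simps)
    let ?\<phi> = "\<lambda>x. r *\<^sub>R x + ((1 - r) *\<^sub>R p + s *\<^sub>R w)"
    have cpt: "compact ?M" "compact ?P" "compact ?O"
      using bounded_hpoly_shift[OF irr bd] by (auto intro!: compact_hpoly)
    have meas: "?M \<in> lmeasurable" "?P \<in> lmeasurable" "?O \<in> lmeasurable"
      using cpt by (auto intro!: lmeasurable_compact)
    have memM: "x \<in> ?M \<longleftrightarrow> x \<in> ?P \<and> a i0 \<bullet> x \<le> b i0 - s" for x
    proof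
      assume x: "x \<in> ?M"
      have "a k \<bullet> x \<le> b k" if "k \<in> I" for k
        using x that s by (cases "k = i0") (force simp: hpoly_def)+
      then show "x \<in> ?P \<and> a i0 \<bullet> x \<le> b i0 - s" using x i0 by (force simp: hpoly_def)
    qed (auto simp: hpoly_def)
    have subO: "?P \<subseteq> ?O"
    proof
      fix x assume x: "x \<in> ?P"
      have "a k \<bullet> x \<le> (b(i0 := b i0 + s)) k" if "k \<in> I" for k
        using x that s by (cases "k = i0") (force simp: hpoly_def)+
      then show "x \<in> ?O" by (simp add: hpoly_def)
    qed
    have img: "?\<phi> ` (?P - ?M) \<subseteq> ?O - ?P"
    proof
      fix y assume "y \<in> ?\<phi> ` (?P - ?M)"
      then obtain x where x: "x \<in> ?P" "x \<notin> ?M" and y: "y = ?\<phi> x" by blast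
      have "\<not> a i0 \<bullet> x \<le> b i0 - s" using x memM by blast
      then have hx: "b i0 - s < a i0 \<bullet> x" "a i0 \<bullet> x \<le> b i0" using x(1) i0 by (auto simp: hpoly_def)
      have ay: "a k \<bullet> y = r * (a k \<bullet> x - a k \<bullet> p) + a k \<bullet> p + s * (a k \<bullet> w)" for k
        by (simp add: y inner_add_right algebra_simps)
      have "r * (a i0 \<bullet> x - b i0) \<le> 0" using hx r by (simp add: mult_nonneg_nonpos)
      then have up: "a i0 \<bullet> y \<le> b i0 + s" by (simp add: ay p w)
      have "r * (- s) < r * (a i0 \<bullet> x - b i0)" using hx r by (intro mult_strict_left_mono) auto
      moreover have "- s \<le> r * (- s)" using r s by simp
      ultimately have lo: "b i0 < a i0 \<bullet> y" by (simp add: ay p w)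
      have "a k \<bullet> y \<le> b k" if k: "k \<in> I - {i0}" for k
      proof -
        have "r * (a k \<bullet> x - a k \<bullet> p) \<le> r * (b k - a k \<bullet> p)"
          using x(1) k r by (intro mult_left_mono) (auto simp: hpoly_def)
        moreover have "s * (a k \<bullet> w) \<le> s * (\<kappa> * (b k - a k \<bullet> p))"
          using \<kappa>(2)[OF k] s by (intro mult_left_mono) auto
        moreover have "r * (b k - a k \<bullet> p) + s * (\<kappa> * (b k - a k \<bullet> p)) = b k - a k \<bullet> p"
          by (simp add: r_def algebra_simps)
        ultimately show ?thesis unfolding ay by linarith
      qed
      then have "y \<in> ?O" using up by (auto simp: hpoly_def)
      moreover have "y \<notin> ?P" using lo i0 by (force simp: hpoly_def)
      ultimately show "y \<in> ?O - ?P" by blast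
    qed
    have inj: "inj ?\<phi>" using r by (auto simp: inj_on_def)
    have "?\<phi> ` (?P - ?M) = ?\<phi> ` ?P - ?\<phi> ` ?M" using inj by (rule image_set_diff)
    moreover have "?\<phi> ` ?P \<in> lmeasurable" "?\<phi> ` ?M \<in> lmeasurable"
      by (intro lmeasurable_compact compact_continuous_image continuous_intros cpt)+
    ultimately have "?\<phi> ` (?P - ?M) \<in> lmeasurable" by (simp add: fmeasurable.Diff)
    then have "measure lebesgue (?\<phi> ` (?P - ?M)) \<le> measure lebesgue (?O - ?P)"
      using img meas by (intro measure_mono_fmeasurable) (auto simp: fmeasurable.Diff)
    then have le: "r ^ 3 * measure lebesgue (?P - ?M) \<le> measure lebesgue (?O - ?P)"
      using r by (simp add: measure_lebesgue_affine)
    have d1: "measure lebesgue (?P - ?M) = measure lebesgue ?P - measure lebesgue ?M"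
      using meas memM by (intro measurable_measure_Diff) auto
    have d2: "measure lebesgue (?O - ?P) = measure lebesgue ?O - measure lebesgue ?P"
      using meas subO by (intro measurable_measure_Diff) auto
    have "1 - 3 * \<kappa> * s \<le> r ^ 3"
      using one_minus_cube_ge[of "\<kappa> * s"] r by (auto simp: r_def)
    then have "(1 - 3 * \<kappa> * s) * measure lebesgue (?P - ?M) \<le> r ^ 3 * measure lebesgue (?P - ?M)"
      by (rule mult_right_mono) simp
    then show ?thesis using le by (simp add: volume_def d1 d2)
  qed
  show ?thesis
  proof (rule that[of "3 * \<kappa>"])
    show "3 * \<kappa> > 0" using \<kappa>(1) by simp
    show "\<forall>\<^sub>F s in at_right 0. (1 - 3 * \<kappa> * s) * (volume (hpoly I a b) - volume (hpoly I a (b(i0 := b i0 - s))))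
       \<le> volume (hpoly I a (b(i0 := b i0 + s))) - volume (hpoly I a b)"
      unfolding eventually_at_right_field using main \<kappa>(1) by (intro exI[of _ "1 / \<kappa>"]) auto
  qed
qed

section \<open>Minimizers are simple\<close>

text \<open>The right-hand factor is a lower bound of second order for the cube root of \<open>1 + y\<close>.\<close>

lemma cube_root_lower_bound:
  fixes e e0 y :: real
  assumes "0 \<le> e" "0 \<le> e0" "\<bar>y\<bar> \<le> 1/2" and cube: "e0 ^ 3 * (1 + y) \<le> e ^ 3"
  shows "e0 * (1 + y/3 - y\<^sup>2) \<le> e"
proof (rule ccontr)
  assume "\<not> ?thesis"
  then have "e < e0 * (1 + y/3 - y\<^sup>2)" by simp
  moreover define h where "h = y/3 - y\<^sup>2"
  ultimately have less: "e < e0 * (1 + h)" by (simp add: add_diff_eq)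
  have y2: "y\<^sup>2 \<le> (1/2) * \<bar>y\<bar>"
    using mult_right_mono[OF assms(3), of "\<bar>y\<bar>"] by (simp add: power2_eq_square abs_mult_self_eq)
  have "\<bar>h\<bar> \<le> \<bar>y\<bar> / 3 + y\<^sup>2" unfolding h_def using abs_triangle_ineq4[of "y/3" "y\<^sup>2"] by simp
  with y2 have h: "\<bar>h\<bar> \<le> (5/6) * \<bar>y\<bar>" by linarith
  then have h2: "h\<^sup>2 \<le> (25/36) * y\<^sup>2"
    using power_mono[OF h, of 2] by (simp add: power_mult_distrib power2_eq_square)
  have h3: "h ^ 3 \<le> (5/12) * h\<^sup>2"
  proof -
    have "h \<le> 5/12" using h assms(3) by linarith
    then show ?thesis using mult_right_mono[of h "5/12" "h\<^sup>2"] by (simp add: power3_eq_cube power2_eq_square mult.assoc)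
  qed
  have "(1 + h) ^ 3 = 1 + 3 * h + 3 * h\<^sup>2 + h ^ 3" by (simp add: power3_eq_cube power2_eq_square algebra_simps)
  also have "\<dots> \<le> 1 + y"
  proof -
    have "3 * h = y - 3 * y\<^sup>2" by (simp add: h_def)
    then show ?thesis using h2 h3 zero_le_power2[of y] by linarith
  qed
  finally have "(1 + h) ^ 3 \<le> 1 + y" .
  have "e ^ 3 < (e0 * (1 + h)) ^ 3"
    using less assms(1) by (intro power_strict_mono) auto
  also have "\<dots> = e0 ^ 3 * (1 + h) ^ 3" by (simp add: power_mult_distrib)
  also have "\<dots> \<le> e0 ^ 3 * (1 + y)" using \<open>(1 + h) ^ 3 \<le> 1 + y\<close> assms(2) by (intro mult_left_mono) auto
  finally show False using cube by simp
qed

text \<open>Minimality bounds \<open>E s\<close> and \<open>E (- s)\<close> from below by the cube roots of the relative volumes. The volume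
gained for \<open>s\<close> falls short of the volume lost for \<open>- s\<close> at most by a term of order \<open>s\<^sup>2\<close>, so the two
bounds add up to at least \<open>2 * E 0\<close> minus a term of order \<open>s\<^sup>2\<close>, which contradicts the linear loss \<open>\<kappa> * s\<close>.\<close>

lemma concave_kink_not_minimal:
  fixes E V :: "real \<Rightarrow> real"
  assumes V0: "V 0 > 0" and \<kappa>: "\<kappa> > 0" and K: "K > 0"
    and E: "\<And>t. E t \<ge> 0"
    and kink: "\<forall>\<^sub>F s in at_right 0. E s + E (- s) \<le> 2 * E 0 - \<kappa> * s"
    and inw: "\<forall>\<^sub>F s in at_right 0. V 0 * (1 - K * s) \<le> V (- s) \<and> V (- s) \<le> V 0"
    and outw: "\<forall>\<^sub>F s in at_right 0. (1 - K * s) * (V 0 - V (- s)) \<le> V s - V 0"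
    and min: "\<forall>\<^sub>F s in at_right 0. E 0 ^ 3 / V 0 * V s \<le> E s ^ 3 \<and> E 0 ^ 3 / V 0 * V (- s) \<le> E (- s) ^ 3"
  shows False
proof -
  have s1: "\<forall>\<^sub>F s in at_right (0::real). 0 < s" by (rule eventually_at_right_less)
  \<comment> \<open>The first bound makes the relative volume changes at most \<open>1/2\<close>; below the second one, the linear term
    \<open>\<kappa> * s\<close> exceeds the quadratic error \<open>3 * E 0 * (K * s)\<^sup>2\<close>.\<close>
  have s2: "\<forall>\<^sub>F s in at_right 0. s < min (1 / (2 * K)) (\<kappa> / (3 * E 0 * K\<^sup>2 + 1))"
    using K \<kappa> E[of 0] by (intro eventually_at_rightI[of 0 "min (1 / (2 * K)) (\<kappa> / (3 * E 0 * K\<^sup>2 + 1))"])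
      (auto intro!: divide_pos_pos add_nonneg_pos)
  have "\<forall>\<^sub>F s in at_right (0::real). False"
    using kink inw outw min s1 s2
  proof eventually_elim
    case (elim s)
    note s = elim(5,6)
    have Ks: "0 \<le> K * s" "K * s \<le> 1/2" using s K by (auto simp: field_simps)
    define x where "x = (V 0 - V (- s)) / V 0"
    have x: "0 \<le> x" "x \<le> K * s" using elim(2) V0 by (auto simp: x_def field_simps)
    have Vm: "V (- s) = V 0 * (1 - x)" using V0 by (simp add: x_def field_simps)
    \<comment> \<open>\<open>x\<close> is the relative loss of volume, \<open>y\<close> a lower bound for the relative gain\<close>
    define y where "y = x - (K * s)\<^sup>2"
    have KKs: "(K * s)\<^sup>2 \<le> K * s" using mult_right_mono[of "K * s" 1 "K * s"] Ks by (simp add: power2_eq_square)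
    have y: "\<bar>y\<bar> \<le> K * s" unfolding y_def using x KKs zero_le_power2[of "K * s"] by linarith
    have Vp: "V 0 * (1 + y) \<le> V s"
    proof -
      have "K * s * x \<le> K * s * (K * s)" using x Ks by (intro mult_left_mono) auto
      then have "y \<le> (1 - K * s) * x" by (simp add: y_def power2_eq_square algebra_simps)
      then have "V 0 * y \<le> V 0 * ((1 - K * s) * x)" using V0 by simp
      also have "\<dots> = (1 - K * s) * (V 0 - V (- s))" by (simp add: Vm algebra_simps)
      finally show ?thesis using elim(3) by (simp add: algebra_simps)
    qed
    have "E 0 ^ 3 * (1 + - x) \<le> E (- s) ^ 3" using elim(4) V0 by (simp add: Vm)
    then have e1: "E 0 * (1 + (- x)/3 - (- x)\<^sup>2) \<le> E (- s)"
      using x Ks E by (intro cube_root_lower_bound) auto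
    have "E 0 ^ 3 * (1 + y) = E 0 ^ 3 / V 0 * (V 0 * (1 + y))" using V0 by simp
    also have "\<dots> \<le> E 0 ^ 3 / V 0 * V s" using Vp V0 E[of 0] by (intro mult_left_mono) auto
    also have "\<dots> \<le> E s ^ 3" using elim(4) by simp
    finally have e2: "E 0 * (1 + y/3 - y\<^sup>2) \<le> E s"
      using y Ks E by (intro cube_root_lower_bound) auto
    have "x\<^sup>2 \<le> (K * s)\<^sup>2" using x by (intro power_mono) auto
    moreover have "y\<^sup>2 \<le> (K * s)\<^sup>2" using y Ks by (simp add: abs_le_square_iff[symmetric])
    moreover have "(- x)\<^sup>2 = x\<^sup>2" by simp
    ultimately have "2 - 3 * (K * s)\<^sup>2 \<le> (1 + (- x)/3 - (- x)\<^sup>2) + (1 + y/3 - y\<^sup>2)"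
      using zero_le_power2[of "K * s"] y_def by linarith
    from mult_left_mono[OF this, of "E 0"] E[of 0]
    have "E 0 * (2 - 3 * (K * s)\<^sup>2) \<le> E 0 * (1 + (- x)/3 - (- x)\<^sup>2) + E 0 * (1 + y/3 - y\<^sup>2)"
      by (simp add: distrib_left[symmetric])
    then have "\<kappa> * s \<le> (3 * E 0 * K\<^sup>2 * s) * s"
      using e1 e2 elim(1) by (simp add: power2_eq_square algebra_simps)
    then have "\<kappa> \<le> 3 * E 0 * K\<^sup>2 * s" using s(1) by simp
    moreover have "s * (3 * E 0 * K\<^sup>2 + 1) < \<kappa>"
    proof -
      have "3 * E 0 * K\<^sup>2 + 1 > 0" using E[of 0] by (intro add_nonneg_pos) auto
      then show ?thesis using s(2) by (simp add: pos_less_divide_eq)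
    qed
    ultimately show False using s(1) by (simp add: algebra_simps)
  qed
  then show False by simp
qed

lemma total_edge_length_nonneg:
  assumes "polytope P" shows "0 \<le> total_edge_length P"
  unfolding total_edge_length_def
proof (rule sum_nonneg)
  fix E assume "E \<in> {E. E edge_of P}"
  then have "polytope E" using face_of_polytope_polytope[OF assms] by (auto simp: edge_of_def)
  then show "0 \<le> diameter E" by (intro diameter_ge_0 polytope_imp_bounded)
qed

lemma convex_polyhedron_hpoly:
  assumes "irredundant I a b" "bounded (hpoly I a b)"
  shows "convex_polyhedron (hpoly I a b)" "num_faces (hpoly I a b) = card I"
proof -
  obtain z where "z \<in> interior (hpoly I a b)"
    using assms strict_point_interior unfolding irredundant_def by blast
  then show "convex_polyhedron (hpoly I a b)"
    using polyhedron_hpoly[of I a b] compact_hpoly[OF assms(2)] assms(1)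
    by (auto simp: convex_polyhedron_def irredundant_def)
  show "num_faces (hpoly I a b) = card I"
    unfolding num_faces_def facet_of_hpoly[OF assms(1)] by (rule card_image[OF hface_inj[OF assms(1)]])
qed

lemma volume_pos:
  assumes "convex_polyhedron P" shows "volume P > 0"
proof -
  obtain x e where "e > 0" "ball x e \<subseteq> P"
    using assms mem_interior unfolding convex_polyhedron_def by blast
  moreover have "P \<in> lmeasurable" using assms lmeasurable_compact unfolding convex_polyhedron_def by blast
  ultimately have le: "measure lebesgue (ball x e) \<le> measure lebesgue P"
    by (intro measure_mono_fmeasurable) auto
  have "measure lebesgue (ball x e) > 0" using content_ball_pos[OF \<open>e > 0\<close>, of x] by simp
  from less_le_trans[OF this le] show ?thesis unfolding volume_def .
qed

text \<open>With four facets through \<open>v\<close>, moving the plane of one of them in both directions keeps the number of facets and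
produces a concave kink of the edge length.\<close>

lemma minimizer_vertex_simple:
  fixes a :: "'i \<Rightarrow> real^3"
  assumes irr: "irredundant I a b" and bd: "bounded (hpoly I a b)"
    and min: "\<And>Q. convex_polyhedron Q \<Longrightarrow> num_faces Q = num_faces (hpoly I a b) \<Longrightarrow>
           melzak_ratio (hpoly I a b) \<le> melzak_ratio Q"
    and v: "v \<in> hpoly I a b"
  shows "card {i \<in> I. a i \<bullet> v = b i} \<le> 3"
proof (rule ccontr)
  assume "\<not> ?thesis"
  then have c4: "4 \<le> card {i \<in> I. a i \<bullet> v = b i}" by simp
  obtain S where S: "S \<subseteq> {i \<in> I. a i \<bullet> v = b i}" "card S = 4"
    using obtain_subset_with_card_n[OF c4] by blast
  then obtain i0 T where T: "S = insert i0 T" "i0 \<notin> T" "card T = 3"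
    using card_Suc_eq[of S 3] by auto
  then obtain i j k where ijk: "T = {i, j, k}" "i \<noteq> j" "i \<noteq> k" "j \<noteq> k"
    by (auto simp: card_3_iff)
  define bt where "bt t = b(i0 := b i0 + t)" for t
  have b0: "bt 0 = b" by (simp add: bt_def)
  have bm: "bt (- s) = b(i0 := b i0 - s)" for s by (simp add: bt_def)
  have I: "i0 \<in> I" "i \<in> I" "j \<in> I" "k \<in> I" "i0 \<notin> {i, j, k}"
    and act: "a i0 \<bullet> v = b i0" "a i \<bullet> v = b i" "a j \<bullet> v = b j" "a k \<bullet> v = b k"
    using S T ijk by auto
  have fin: "finite I" using irr by (simp add: irredundant_def)
  have bds: "bounded (hpoly I a (bt t))" for t using bounded_hpoly_shift[OF irr bd] .
  obtain \<kappa> where \<kappa>: "\<kappa> > 0" "\<forall>\<^sub>F s in at_right 0. total_edge_length (hpoly I a (b(i0 := b i0 + s)))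
        + total_edge_length (hpoly I a (b(i0 := b i0 - s))) \<le> 2 * total_edge_length (hpoly I a b) - \<kappa> * s"
    using edge_length_concave_kink[OF irr bd I(1-4) ijk(2-4) I(5) v act] .
  obtain K1 where K1: "K1 > 0" "\<forall>\<^sub>F s in at_right 0. volume (hpoly I a b) * (1 - K1 * s) \<le> volume (hpoly I a (b(i0 := b i0 - s)))
       \<and> volume (hpoly I a (b(i0 := b i0 - s))) \<le> volume (hpoly I a b)"
    using volume_inward_shift[OF irr bd I(1)] .
  obtain K2 where K2: "K2 > 0" "\<forall>\<^sub>F s in at_right 0. (1 - K2 * s) * (volume (hpoly I a b) - volume (hpoly I a (b(i0 := b i0 - s))))
       \<le> volume (hpoly I a (b(i0 := b i0 + s))) - volume (hpoly I a b)"
    using volume_outward_shift[OF irr bd I(1)] .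
  define K where "K = max K1 K2"
  have V0: "volume (hpoly I a b) > 0" using volume_pos convex_polyhedron_hpoly(1)[OF irr bd] by blast
  let ?E = "\<lambda>t. total_edge_length (hpoly I a (bt t))" and ?V = "\<lambda>t. volume (hpoly I a (bt t))"
  have better: "?E 0 ^ 3 / ?V 0 * ?V t \<le> ?E t ^ 3" if "irredundant I a (bt t)" for t
  proof -
    note cp = convex_polyhedron_hpoly[OF that bds] convex_polyhedron_hpoly[OF irr bd]
    have "melzak_ratio (hpoly I a b) \<le> melzak_ratio (hpoly I a (bt t))"
      using min cp by simp
    moreover have "?V t > 0" using volume_pos cp(1) by blast
    ultimately show ?thesis by (simp add: melzak_ratio_def b0 pos_le_divide_eq)
  qed
  have irt: "\<forall>\<^sub>F t in nhds 0. irredundant I a (bt t)"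
    unfolding bt_def using irredundant_shift[OF irr I(1)] .
  have irp: "\<forall>\<^sub>F s in at_right 0. irredundant I a (bt s)"
    using irt by (rule filter_leD[rotated]) (simp add: at_within_def)
  have irm: "\<forall>\<^sub>F s in at_right 0. irredundant I a (bt (- s))"
  proof -
    have "((\<lambda>s::real. - s) \<longlongrightarrow> - 0) (at_right 0)" by (intro tendsto_intros)
    then have "filterlim (\<lambda>s::real. - s) (nhds 0) (at_right 0)" by simp
    then show ?thesis using irt unfolding filterlim_iff by blast
  qed
  have Kmul: "K1 * s \<le> K * s" "K2 * s \<le> K * s" if "s > 0" for s :: real
    using that by (auto simp: K_def)
  have pos: "\<forall>\<^sub>F s in at_right (0::real). 0 < s" by (rule eventually_at_right_less)
  show False
  proof (rule concave_kink_not_minimal[of ?V \<kappa> K ?E])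
    show "?V 0 > 0" using V0 b0 by simp
    show "\<kappa> > 0" by (rule \<kappa>)
    show "K > 0" using K1(1) by (simp add: K_def)
    show "?E t \<ge> 0" for t using total_edge_length_nonneg polytope_hpoly[OF fin bds] by blast
    show "\<forall>\<^sub>F s in at_right 0. ?E s + ?E (- s) \<le> 2 * ?E 0 - \<kappa> * s"
      using \<kappa>(2) unfolding b0 bm unfolding bt_def .
    show "\<forall>\<^sub>F s in at_right 0. ?V 0 * (1 - K * s) \<le> ?V (- s) \<and> ?V (- s) \<le> ?V 0"
      using K1(2) pos unfolding b0 bm
    proof eventually_elim
      case (elim s)
      have "volume (hpoly I a b) * (1 - K * s) \<le> volume (hpoly I a b) * (1 - K1 * s)"
        using Kmul[OF elim(2)] V0 by (intro mult_left_mono) auto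
      then show ?case using elim by linarith
    qed
    show "\<forall>\<^sub>F s in at_right 0. (1 - K * s) * (?V 0 - ?V (- s)) \<le> ?V s - ?V 0"
      using K1(2) K2(2) pos unfolding b0 bm
    proof eventually_elim
      case (elim s)
      have "(1 - K * s) * (volume (hpoly I a b) - volume (hpoly I a (b(i0 := b i0 - s))))
        \<le> (1 - K2 * s) * (volume (hpoly I a b) - volume (hpoly I a (b(i0 := b i0 - s))))"
        using Kmul[OF elim(3)] elim(1) by (intro mult_right_mono) auto
      then show ?case using elim(2) unfolding bt_def by linarith
    qed
    show "\<forall>\<^sub>F s in at_right 0. ?E 0 ^ 3 / ?V 0 * ?V s \<le> ?E s ^ 3 \<and> ?E 0 ^ 3 / ?V 0 * ?V (- s) \<le> ?E (- s) ^ 3"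
      using irp irm by eventually_elim (use better in blast)
  qed
qed

text \<open>With fewer tight inequalities there is a direction orthogonal to all their normals, along which \<open>v\<close> can be
moved both ways.\<close>

lemma extreme_point_three_active:
  fixes a :: "'i \<Rightarrow> real^3"
  assumes fin: "finite I" and v: "v extreme_point_of hpoly I a b"
  shows "3 \<le> card {i \<in> I. a i \<bullet> v = b i}"
proof (rule ccontr)
  let ?act = "{i \<in> I. a i \<bullet> v = b i}"
  assume "\<not> ?thesis"
  moreover have "card (a ` ?act) \<le> card ?act" using fin by (intro card_image_le) simp
  ultimately have "card (a ` ?act) < 3" by linarith
  then have "dim (a ` ?act) < DIM(real^3)" using dim_le_card'[of "a ` ?act"] fin by simp
  then obtain d where d: "d \<noteq> 0" "\<And>y. y \<in> span (a ` ?act) \<Longrightarrow> orthogonal d y"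
    using orthogonal_to_subspace_exists by blast
  have d0: "a i \<bullet> d = 0" if "i \<in> ?act" for i
  proof -
    have "orthogonal d (a i)" by (rule d(2)) (use that in \<open>simp add: span_base\<close>)
    then show ?thesis by (simp add: orthogonal_def inner_commute)
  qed
  have vP: "v \<in> hpoly I a b" using v by (simp add: extreme_point_of_def)
  have "open {x. \<forall>m\<in>I - ?act. a m \<bullet> x < b m}" using strict_points_open fin by blast
  moreover have "v \<in> {x. \<forall>m\<in>I - ?act. a m \<bullet> x < b m}" using vP by (auto simp: hpoly_def less_le)
  ultimately obtain e where e: "e > 0" "ball v e \<subseteq> {x. \<forall>m\<in>I - ?act. a m \<bullet> x < b m}"
    using open_contains_ball by blast
  define w where "w = (e / (2 * norm d)) *\<^sub>R d"
  have w: "w \<noteq> 0" "norm w < e" using e d(1) by (auto simp: w_def)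
  have in_P: "v + t *\<^sub>R w \<in> hpoly I a b" if "\<bar>t\<bar> \<le> 1" for t
  proof -
    have "norm (t *\<^sub>R w) \<le> norm w" using that by (simp add: mult_left_le_one_le)
    from le_less_trans[OF this w(2)] have ball: "v + t *\<^sub>R w \<in> ball v e" by (simp add: dist_norm)
    have "a m \<bullet> (v + t *\<^sub>R w) \<le> b m" if m: "m \<in> I" for m
    proof (cases "m \<in> ?act")
      case True
      then show ?thesis using d0[OF True] by (simp add: inner_add_right w_def)
    next
      case False
      then show ?thesis using subsetD[OF e(2) ball] m by (simp add: less_imp_le)
    qed
    then show ?thesis by (simp add: hpoly_def)
  qed
  have "v + w \<in> hpoly I a b" "v - w \<in> hpoly I a b" using in_P[of 1] in_P[of "-1"] by auto
  moreover have "v \<in> open_segment (v + w) (v - w)"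
  proof -
    have "v = midpoint (v + w) (v - w)" by (simp add: midpoint_def)
    moreover have "v + w \<noteq> v - w"
    proof
      assume "v + w = v - w"
      then have "2 *\<^sub>R w = 0" by (simp add: scaleR_2)
      then show False using w by simp
    qed
    ultimately show ?thesis by (metis midpoint_in_open_segment)
  qed
  ultimately show False using v by (auto simp: extreme_point_of_def)
qed

theorem corollary2p4:
  fixes P :: "nat \<Rightarrow> (real^3) set"
  assumes "\<And>n. n \<ge> 1 \<Longrightarrow> convex_polyhedron (P n)"
    and "(\<lambda>n. melzak_ratio (P n)) \<longlonglongrightarrow> (INF Q\<in>{Q. convex_polyhedron Q}. melzak_ratio Q)"
    and "\<And>n. n \<ge> 1 \<Longrightarrow> \<not> equal_up_to_scaling (P n) (P (Suc n)) \<Longrightarrow>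
           num_faces (P n) < num_faces (P (Suc n))"
    and "\<And>n Q. n \<ge> 1 \<Longrightarrow> convex_polyhedron Q \<Longrightarrow> num_faces Q = num_faces (P n) \<Longrightarrow>
           melzak_ratio (P n) \<le> melzak_ratio Q"
  shows "\<forall>n\<ge>1. \<forall>v. v extreme_point_of (P n) \<longrightarrow> vertex_degree (P n) v = 3"
proof (intro allI impI)
  fix n v assume n: "1 \<le> n" and v: "v extreme_point_of (P n)"
  have cp: "convex_polyhedron (P n)" using assms(1) n .
  then obtain I :: "(real^3) set set" and a b where irr: "irredundant I a b" and P: "P n = hpoly I a b"
    using exists_irredundant_representation unfolding convex_polyhedron_def by metis
  have "compact (P n)" using cp by (simp add: convex_polyhedron_def)
  then have bd: "bounded (hpoly I a b)" unfolding P by (rule compact_imp_bounded)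
  have vP: "v \<in> hpoly I a b" using v P by (simp add: extreme_point_of_def)
  have "card {i \<in> I. a i \<bullet> v = b i} \<le> 3"
    using minimizer_vertex_simple[OF irr bd _ vP] assms(4)[OF n] unfolding P by blast
  moreover have "3 \<le> card {i \<in> I. a i \<bullet> v = b i}"
    using extreme_point_three_active v irr unfolding P irredundant_def by blast
  ultimately show "vertex_degree (P n) v = 3"
    unfolding P using degree_of_simple_vertex[OF irr vP] by simp
qed

end
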